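(* Let $(\mathcal{C},\mathcal{M})$ be an adhesive HLR category. Let $\rho_1,\rho_2$ be $\mathcal{M}$-weak spans, let $G,H_1,H$ be objects of $\mathcal{C}$, and let $\gamma_1\in\Delta^{\mathrm{PO}}(G,\rho_1)$ be a Weak Double-Pushout such that $G\stackrel{\gamma_1}{\Longrightarrow}H_1$. Then: 1. (analysis) to any $\gamma_2\in\Delta^{\mathrm{PO}}(G,\rho_2)$ such that $\gamma_1,\gamma_2$ are parallel independent and $G\stackrel{(\gamma_1,\gamma_2)}{\Longrightarrow}H$, one can associate a $\gamma_2'\in\Delta^{\mathrm{PO}}(H_1,\rho_2)$ with $H_1\stackrel{\gamma_2'}{\Longrightarrow}H$ such that $G\stackrel{\gamma_1}{\Longrightarrow}H_1\stackrel{\gamma_2'}{\Longrightarrow}H$ is sequential independent (i.e., $\gamma_1$ and $\gamma_2'$ are sequential independent); 2. (synthesis) to any $\gamma_2'\in\Delta^{\mathrm{PO}}(H_1,\rho_2)$ such that $G\stackrel{\gamma_1}{\Longrightarrow}H_1\stackrel{\gamma_2'}{\Longrightarrow}H$ is sequential independent, one can associate a $\gamma_2\in\Delta^{\mathrm{PO}}(G,\rho_2)$ such that $\gamma_1,\gamma_2$ are parallel independent and $G\stackrel{(\gamma_1,\gamma_2)}{\Longrightarrow}H$; 3. these two correspondences are inverse to each other up to isomorphism.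
   Context: **Adhesive HLR category.** A pair $(\mathcal{C},\mathcal{M})$ of a category $\mathcal{C}$ and a class $\mathcal{M}$ of monomorphisms of $\mathcal{C}$ such that: (i) $\mathcal{M}$ contains all isomorphisms, is closed under composition and under decomposition ($g\circ f\in\mathcal{M}$ and $g\in\mathcal{M}$ imply $f\in\mathcal{M}$); (ii) $\mathcal{C}$ has pushouts and pullbacks along $\mathcal{M}$-morphisms (i.e., when at least one of the two given morphisms is in $\mathcal{M}$), and $\mathcal{M}$ is closed under pushouts and pullbacks (the morphism opposite to an $\mathcal{M}$-morphism in a pushout or pullback square is in $\mathcal{M}$); (iii) pushouts along $\mathcal{M}$-morphisms are Van Kampen squares: for every commutative cube having such a pushout as bottom face and whose two back faces are pullbacks, the top face is a pushout iff the two front faces are pullbacks. **Limits and colimits.** For morphisms $f_1:D_1\to G,\dots,f_p:D_p\to G$, a limit of $(f_1,\dots,f_p,G)$ is $(C,e_1,\dots,e_p)$ with $e_a:C\to D_a$ and $f_a\circ e_a=f_b\circ e_b$ for all $a,b$, such that for any other $(C',e_1',\dots,e_p')$ with $f_a\circ e'_a=f_b\circ e'_b$ for all $a,b$ there is a unique $u:C'\to C$ with $e_a'=e_a\circ u$ for all $a$. Colimits of $(C,s_1,\dots,s_p)$ with $s_a:C\to F_a$ are defined dually. Writing "$(g,n,H)$ is a pushout of $(I,r,d)$" means that $g\circ d=n\circ r$ is a pushout square with apex $I$ and corner $H$. **Weak spans.** A weak span $\rho$ is a diagram $L\xleftarrow{l}K\xleftarrow{i}I\xrightarrow{r}R$ in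 $\mathcal{C}$; it is an $\mathcal{M}$-weak span if $l,i,r\in\mathcal{M}$. Objects and morphisms of an indexed weak span or direct transformation carry the same index. **Direct transformations.** A direct transformation $\gamma$ of an object $G$ by $\rho$ consists of objects $D,H$ and morphisms $m:L\to G$, $k:K\to D$, $f:D\to G$, $g:D\to H$, $n:R\to H$ such that $f\circ k=m\circ l$ and $(g,n,H)$ is a pushout of $(I,r,k\circ i)$; one writes $G\stackrel{\gamma}{\Longrightarrow}H$. If moreover $(f,m,G)$ is a pushout of $(K,l,k)$, $\gamma$ is a Weak Double-Pushout; $\Delta^{\mathrm{PO}}(G,\rho)$ is the set of Weak Double-Pushouts of $G$ by $\rho$. **Associated span.** For an $\mathcal{M}$-weak span $\rho$, let $(i',r',R')$ be a pushout of $(I,i,r)$, with $i':R\to R'$ and $r':K\to R'$ (so $i'\circ r=r'\circ i$). The associated span $\check\rho$ is $L\xleftarrow{l}K\xrightarrow{r'}R'$. For $\gamma\in\Delta^{\mathrm{PO}}(G,\rho)$ there is a unique $n':R'\to H$ such that $n'\circ i'=n$ and $n'\circ r'=g\circ k$; $\check\gamma$ is the double-pushout diagram of $G$ by $\check\rho$ given by $m,k,f,g,n'$. **Parallel independence.** $\gamma_1\in\Delta^{\mathrm{PO}}(G,\rho_1)$ and $\gamma_2\in\Delta^{\mathrm{PO}}(G,\rho_2)$ are parallel independent if there exist morphisms $j_1:L_1\to D_2$ and $j_2:L_2\to D_1$ such that $f_2\circ j_1=m_1$ and $f_1\circ j_2=m_2$. **Sequential independence.** Given $\gamma_1\in\Delta^{\mathrm{PO}}(G,\rho_1)$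 with $G\stackrel{\gamma_1}{\Longrightarrow}H_1$ and $\gamma_2\in\Delta^{\mathrm{PO}}(H_1,\rho_2)$, $\gamma_1$ and $\gamma_2$ are sequential independent if there exist morphisms $j_1':R_1'\to D_2$ and $j_2':L_2\to D_1$ such that $f_2\circ j_1'=n_1'$ and $g_1\circ j_2'=m_2$, where $R'_1$ is the right-hand object of $\check\rho_1$ and $n'_1:R'_1\to H_1$ is the morphism of $\check\gamma_1$, i.e., the unique morphism such that $n'_1\circ i'_1=n_1$ and $n'_1\circ r'_1=g_1\circ k_1$. **Parallel coherent diagrams and PCTs.** A parallel coherent diagram $\Gamma$ for $G$ is a commuting diagram constituted of direct transformations $\gamma_1,\dots,\gamma_p$ of $G$ by weak spans $\rho_1,\dots,\rho_p$ ($p\ge1$) and morphisms $j_a^b:I_a\to D_b$ for all $1\le a,b\le p$; thus $f_b\circ j_a^b=f_a\circ k_a\circ i_a$ for all $a,b$, and $j_a^a=k_a\circ i_a$. A parallel coherent transformation (PCT) of $G$ by $\Gamma$ consists of: a limit $(C,e_1,\dots,e_p)$ of $(f_1,\dots,f_p,G)$; for each $c$, the unique morphism $d_c:I_c\to C$ such that $j_c^a=e_a\circ d_c$ for all $a$; for each $a$, a pushout $(s_a,o_a,F_a)$ of $(I_a,r_a,d_a)$, with $s_a:C\to F_a$ and $o_a:R_a\to F_a$; and a colimit $(h_1,\dots,h_p,H)$ of $(C,s_1,\dots,s_p)$. If such data exist one writes $G\stackrel{\Gamma}{\Longrightarrow}H$. If $\gamma_1,\gamma_2$ are parallel independent Weak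 Double-Pushouts of $G$ (via $j_1,j_2$), $(\gamma_1,\gamma_2)$ denotes the parallel coherent diagram formed by $\gamma_1,\gamma_2$ with $j_1^2=j_1\circ l_1\circ i_1$, $j_2^1=j_2\circ l_2\circ i_2$ and $j_a^a=k_a\circ i_a$ for $a=1,2$. **Up to isomorphism.** Two direct transformations of the same object by the same weak span are isomorphic if there are isomorphisms between their objects $D$ and between their objects $H$ which, together with the identities on the transformed object and on the weak span, commute with all morphisms of the diagrams. *)

theory Defs
  imports Main
begin

section \<open>Categories, pushouts and pullbacks, limits and colimits\<close>

record ('o, 'm) precategory =
  Obj :: "'o set"
  Mor :: "'m set"
  Dom :: "'m \<Rightarrow> 'o"
  Cod :: "'m \<Rightarrow> 'o"
  Id :: "'o \<Rightarrow> 'm"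
  Comp :: "'m \<Rightarrow> 'm \<Rightarrow> 'm" (infixl "\<cdot>\<index>" 70)

definition Hom :: "('o, 'm) precategory \<Rightarrow> 'o \<Rightarrow> 'o \<Rightarrow> 'm set" where
  "Hom C A B = {f \<in> Mor C. Dom C f = A \<and> Cod C f = B}"

locale category =
  fixes C :: "('o, 'm) precategory" (structure)
  assumes Dom_Obj: "f \<in> Mor C \<Longrightarrow> Dom C f \<in> Obj C"
    and Cod_Obj: "f \<in> Mor C \<Longrightarrow> Cod C f \<in> Obj C"
    and Id_Hom: "A \<in> Obj C \<Longrightarrow> Id C A \<in> Hom C A A"
    and Comp_Hom: "f \<in> Hom C X Y \<Longrightarrow> g \<in> Hom C Y Z \<Longrightarrow> g \<cdot> f \<in> Hom C X Z"
    and Comp_assoc: "f \<in> Hom C W X \<Longrightarrow> g \<in> Hom C X Y \<Longrightarrow> h \<in> Hom C Y Z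
      \<Longrightarrow> (h \<cdot> g) \<cdot> f = h \<cdot> (g \<cdot> f)"
    and Comp_Id_right: "f \<in> Hom C X Y \<Longrightarrow> f \<cdot> Id C X = f"
    and Comp_Id_left: "f \<in> Hom C X Y \<Longrightarrow> Id C Y \<cdot> f = f"

context
  fixes C :: "('o, 'm) precategory" (structure)
begin

definition is_mono :: "'m \<Rightarrow> bool" where
  "is_mono f \<longleftrightarrow> f \<in> Mor C \<and>
    (\<forall>X. \<forall>x \<in> Hom C X (Dom C f). \<forall>y \<in> Hom C X (Dom C f). f \<cdot> x = f \<cdot> y \<longrightarrow> x = y)"

definition is_iso :: "'m \<Rightarrow> bool" where
  "is_iso f \<longleftrightarrow> f \<in> Mor C \<and>
    (\<exists>g \<in> Hom C (Cod C f) (Dom C f). g \<cdot> f = Id C (Dom C f) \<and> f \<cdot> g = Id C (Cod C f))"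

text \<open>\<open>is_pushout C g n H I r d\<close>: the triple \<open>(g, n, H)\<close> is a pushout of the span \<open>(I, r, d)\<close>.
  Note that \<open>g\<close> is opposite to \<open>r\<close>, and \<open>n\<close> is opposite to \<open>d\<close>.\<close>

definition is_pushout :: "'m \<Rightarrow> 'm \<Rightarrow> 'o \<Rightarrow> 'o \<Rightarrow> 'm \<Rightarrow> 'm \<Rightarrow> bool" where
  "is_pushout g n H I r d \<longleftrightarrow>
    (\<exists>R D. r \<in> Hom C I R \<and> d \<in> Hom C I D \<and> g \<in> Hom C D H \<and> n \<in> Hom C R H \<and>
      g \<cdot> d = n \<cdot> r \<and>
      (\<forall>X. \<forall>x \<in> Hom C D X. \<forall>y \<in> Hom C R X. x \<cdot> d = y \<cdot> r \<longrightarrow>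
        (\<exists>!u. u \<in> Hom C H X \<and> u \<cdot> g = x \<and> u \<cdot> n = y)))"

text \<open>\<open>is_pullback C P p q f g Z\<close>: the triple \<open>(P, p, q)\<close> is a pullback of the cospan \<open>(f, g, Z)\<close>.
  Here \<open>p\<close> is opposite to \<open>g\<close>, and \<open>q\<close> is opposite to \<open>f\<close>.\<close>

definition is_pullback :: "'o \<Rightarrow> 'm \<Rightarrow> 'm \<Rightarrow> 'm \<Rightarrow> 'm \<Rightarrow> 'o \<Rightarrow> bool" where
  "is_pullback P p q f g Z \<longleftrightarrow>
    (\<exists>A B. f \<in> Hom C A Z \<and> g \<in> Hom C B Z \<and> p \<in> Hom C P A \<and> q \<in> Hom C P B \<and>
      f \<cdot> p = g \<cdot> q \<and>
      (\<forall>X. \<forall>x \<in> Hom C X A. \<forall>y \<in> Hom C X B. f \<cdot> x = g \<cdot> y \<longrightarrow>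
        (\<exists>!u. u \<in> Hom C X P \<and> p \<cdot> u = x \<and> q \<cdot> u = y)))"

text \<open>Families are indexed by \<open>{1..p}\<close>; values outside this range are irrelevant.\<close>

definition is_limit ::
  "nat \<Rightarrow> 'o \<Rightarrow> (nat \<Rightarrow> 'm) \<Rightarrow> (nat \<Rightarrow> 'm) \<Rightarrow> 'o \<Rightarrow> bool" where
  "is_limit p L e f G \<longleftrightarrow> L \<in> Obj C \<and> G \<in> Obj C \<and>
    (\<forall>a\<in>{1..p}. f a \<in> Mor C \<and> Cod C (f a) = G \<and> e a \<in> Hom C L (Dom C (f a))) \<and>
    (\<forall>a\<in>{1..p}. \<forall>b\<in>{1..p}. f a \<cdot> e a = f b \<cdot> e b) \<and>
    (\<forall>L' e'. L' \<in> Obj C \<and> (\<forall>a\<in>{1..p}. e' a \<in> Hom C L' (Dom C (f a))) \<and>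
        (\<forall>a\<in>{1..p}. \<forall>b\<in>{1..p}. f a \<cdot> e' a = f b \<cdot> e' b) \<longrightarrow>
      (\<exists>!u. u \<in> Hom C L' L \<and> (\<forall>a\<in>{1..p}. e' a = e a \<cdot> u)))"

definition is_colimit ::
  "nat \<Rightarrow> (nat \<Rightarrow> 'm) \<Rightarrow> 'o \<Rightarrow> 'o \<Rightarrow> (nat \<Rightarrow> 'm) \<Rightarrow> bool" where
  "is_colimit p h H L s \<longleftrightarrow> H \<in> Obj C \<and> L \<in> Obj C \<and>
    (\<forall>a\<in>{1..p}. s a \<in> Mor C \<and> Dom C (s a) = L \<and> h a \<in> Hom C (Cod C (s a)) H) \<and>
    (\<forall>a\<in>{1..p}. \<forall>b\<in>{1..p}. h a \<cdot> s a = h b \<cdot> s b) \<and>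
    (\<forall>H' h'. H' \<in> Obj C \<and> (\<forall>a\<in>{1..p}. h' a \<in> Hom C (Cod C (s a)) H') \<and>
        (\<forall>a\<in>{1..p}. \<forall>b\<in>{1..p}. h' a \<cdot> s a = h' b \<cdot> s b) \<longrightarrow>
      (\<exists>!u. u \<in> Hom C H H' \<and> (\<forall>a\<in>{1..p}. h' a = u \<cdot> h a)))"

text \<open>The square \<open>v \<cdot> f = w \<cdot> g\<close> is the bottom face of the cubes below; primed morphisms form the
  top face, and \<open>a, b, c, d\<close> are the vertical morphisms from the top to the bottom.\<close>

definition van_Kampen :: "'m \<Rightarrow> 'm \<Rightarrow> 'm \<Rightarrow> 'm \<Rightarrow> bool" where
  "van_Kampen f g v w \<longleftrightarrow>
    (\<forall>A' B' C' D' f' g' v' w' a b c d.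
      f' \<in> Hom C A' B' \<and> g' \<in> Hom C A' C' \<and> v' \<in> Hom C B' D' \<and> w' \<in> Hom C C' D' \<and>
      a \<in> Hom C A' (Dom C f) \<and> b \<in> Hom C B' (Cod C f) \<and>
      c \<in> Hom C C' (Cod C g) \<and> d \<in> Hom C D' (Cod C v) \<and>
      v' \<cdot> f' = w' \<cdot> g' \<and> v \<cdot> b = d \<cdot> v' \<and> w \<cdot> c = d \<cdot> w' \<and>
      is_pullback A' a f' f b (Cod C f) \<and> is_pullback A' a g' g c (Cod C g) \<longrightarrow>
      (is_pushout w' v' D' A' f' g' \<longleftrightarrow>
        is_pullback B' b v' v d (Cod C v) \<and> is_pullback C' c w' w d (Cod C w)))"

end


section \<open>Adhesive HLR categories\<close>

locale adhesive_hlr = category C for C :: "('o, 'm) precategory" (structure) +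
  fixes M :: "'m set"
  assumes M_mono: "f \<in> M \<Longrightarrow> is_mono C f"
    and M_iso: "is_iso C f \<Longrightarrow> f \<in> M"
    and M_comp: "f \<in> Hom C X Y \<Longrightarrow> g \<in> Hom C Y Z \<Longrightarrow> f \<in> M \<Longrightarrow> g \<in> M \<Longrightarrow> g \<cdot> f \<in> M"
    and M_decomp: "f \<in> Hom C X Y \<Longrightarrow> g \<in> Hom C Y Z \<Longrightarrow> g \<cdot> f \<in> M \<Longrightarrow> g \<in> M \<Longrightarrow> f \<in> M"
    and M_pushout_ex: "r \<in> Hom C I R \<Longrightarrow> d \<in> Hom C I D \<Longrightarrow> r \<in> M \<or> d \<in> M
      \<Longrightarrow> \<exists>g n H. is_pushout C g n H I r d"
    and M_pullback_ex: "f \<in> Hom C A Z \<Longrightarrow> g \<in> Hom C B Z \<Longrightarrow> f \<in> M \<or> g \<in> M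
      \<Longrightarrow> \<exists>P p q. is_pullback C P p q f g Z"
    and M_pushout_closed: "is_pushout C g n H I r d \<Longrightarrow> (r \<in> M \<longrightarrow> g \<in> M) \<and> (d \<in> M \<longrightarrow> n \<in> M)"
    and M_pullback_closed: "is_pullback C P p q f g Z \<Longrightarrow> (f \<in> M \<longrightarrow> q \<in> M) \<and> (g \<in> M \<longrightarrow> p \<in> M)"
    and M_van_Kampen: "is_pushout C w v D A f g \<Longrightarrow> f \<in> M \<or> g \<in> M \<Longrightarrow> van_Kampen C f g v w"


section \<open>Weak spans and direct transformations\<close>

text \<open>The weak span \<open>L \<leftarrow>l\<midarrow> K \<leftarrow>i\<midarrow> I \<midarrow>r\<rightarrow> R\<close>.\<close>

record ('o, 'm) weak_span =
  L_of :: 'o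
  K_of :: 'o
  I_of :: 'o
  R_of :: 'o
  l_of :: 'm
  i_of :: 'm
  r_of :: 'm

text \<open>\<open>H_of \<gamma>\<close> is the result of the transformation. The transformed object \<open>G\<close> and the weak span
  are not stored; they are parameters of the predicates below.\<close>

record ('o, 'm) transformation =
  D_of :: 'o
  H_of :: 'o
  m_of :: 'm
  k_of :: 'm
  f_of :: 'm
  g_of :: 'm
  n_of :: 'm

text \<open>A family of \<open>size_of \<Gamma>\<close> weak spans and transformations, and \<open>j_of \<Gamma> a b\<close> for \<open>j\<^sub>a\<^sup>b : I\<^sub>a \<rightarrow> D\<^sub>b\<close>.\<close>

record ('o, 'm) parallel_diagram =
  size_of :: nat
  span_of :: "nat \<Rightarrow> ('o, 'm) weak_span"
  trans_of :: "nat \<Rightarrow> ('o, 'm) transformation"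
  j_of :: "nat \<Rightarrow> nat \<Rightarrow> 'm"

context
  fixes C :: "('o, 'm) precategory" (structure)
begin

definition is_weak_span :: "('o, 'm) weak_span \<Rightarrow> bool" where
  "is_weak_span \<rho> \<longleftrightarrow>
    L_of \<rho> \<in> Obj C \<and> K_of \<rho> \<in> Obj C \<and> I_of \<rho> \<in> Obj C \<and> R_of \<rho> \<in> Obj C \<and>
    l_of \<rho> \<in> Hom C (K_of \<rho>) (L_of \<rho>) \<and>
    i_of \<rho> \<in> Hom C (I_of \<rho>) (K_of \<rho>) \<and>
    r_of \<rho> \<in> Hom C (I_of \<rho>) (R_of \<rho>)"

definition is_M_weak_span :: "'m set \<Rightarrow> ('o, 'm) weak_span \<Rightarrow> bool" where
  "is_M_weak_span M \<rho> \<longleftrightarrow> is_weak_span \<rho> \<and> l_of \<rho> \<in> M \<and> i_of \<rho> \<in> M \<and> r_of \<rho> \<in> M"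

definition is_direct_transformation ::
  "'o \<Rightarrow> ('o, 'm) weak_span \<Rightarrow> ('o, 'm) transformation \<Rightarrow> bool" where
  "is_direct_transformation G \<rho> \<gamma> \<longleftrightarrow>
    D_of \<gamma> \<in> Obj C \<and> H_of \<gamma> \<in> Obj C \<and>
    m_of \<gamma> \<in> Hom C (L_of \<rho>) G \<and>
    k_of \<gamma> \<in> Hom C (K_of \<rho>) (D_of \<gamma>) \<and>
    f_of \<gamma> \<in> Hom C (D_of \<gamma>) G \<and>
    g_of \<gamma> \<in> Hom C (D_of \<gamma>) (H_of \<gamma>) \<and>
    n_of \<gamma> \<in> Hom C (R_of \<rho>) (H_of \<gamma>) \<and>
    f_of \<gamma> \<cdot> k_of \<gamma> = m_of \<gamma> \<cdot> l_of \<rho> \<and>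
    is_pushout C (g_of \<gamma>) (n_of \<gamma>) (H_of \<gamma>) (I_of \<rho>) (r_of \<rho>) (k_of \<gamma> \<cdot> i_of \<rho>)"

text \<open>\<open>\<Delta>\<^sup>P\<^sup>O(G, \<rho>)\<close>\<close>

definition weak_double_pushouts ::
  "'o \<Rightarrow> ('o, 'm) weak_span \<Rightarrow> ('o, 'm) transformation set" where
  "weak_double_pushouts G \<rho> = {\<gamma>. is_direct_transformation G \<rho> \<gamma> \<and>
    is_pushout C (f_of \<gamma>) (m_of \<gamma>) G (K_of \<rho>) (l_of \<rho>) (k_of \<gamma>)}"

text \<open>Both arguments are meant to be transformations of the same object by the same weak span.
  Commutation with the identities on the transformed object and on \<open>L\<close> forces equal matches.\<close>

definition transformation_iso ::
  "('o, 'm) transformation \<Rightarrow> ('o, 'm) transformation \<Rightarrow> bool" where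
  "transformation_iso \<gamma> \<gamma>' \<longleftrightarrow>
    (\<exists>\<phi> \<psi>. \<phi> \<in> Hom C (D_of \<gamma>) (D_of \<gamma>') \<and> is_iso C \<phi> \<and>
      \<psi> \<in> Hom C (H_of \<gamma>) (H_of \<gamma>') \<and> is_iso C \<psi> \<and>
      m_of \<gamma>' = m_of \<gamma> \<and>
      k_of \<gamma>' = \<phi> \<cdot> k_of \<gamma> \<and>
      f_of \<gamma>' \<cdot> \<phi> = f_of \<gamma> \<and>
      g_of \<gamma>' \<cdot> \<phi> = \<psi> \<cdot> g_of \<gamma> \<and>
      n_of \<gamma>' = \<psi> \<cdot> n_of \<gamma>)"


section \<open>Parallel and sequential independence\<close>

definition parallel_independent_via ::
  "('o, 'm) weak_span \<Rightarrow> ('o, 'm) transformation \<Rightarrow>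
   ('o, 'm) weak_span \<Rightarrow> ('o, 'm) transformation \<Rightarrow> 'm \<Rightarrow> 'm \<Rightarrow> bool" where
  "parallel_independent_via \<rho>1 \<gamma>1 \<rho>2 \<gamma>2 j1 j2 \<longleftrightarrow>
    j1 \<in> Hom C (L_of \<rho>1) (D_of \<gamma>2) \<and> j2 \<in> Hom C (L_of \<rho>2) (D_of \<gamma>1) \<and>
    f_of \<gamma>2 \<cdot> j1 = m_of \<gamma>1 \<and> f_of \<gamma>1 \<cdot> j2 = m_of \<gamma>2"

definition parallel_independent ::
  "('o, 'm) weak_span \<Rightarrow> ('o, 'm) transformation \<Rightarrow>
   ('o, 'm) weak_span \<Rightarrow> ('o, 'm) transformation \<Rightarrow> bool" where
  "parallel_independent \<rho>1 \<gamma>1 \<rho>2 \<gamma>2 \<longleftrightarrow>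
    (\<exists>j1 j2. parallel_independent_via \<rho>1 \<gamma>1 \<rho>2 \<gamma>2 j1 j2)"

text \<open>The associated span is \<open>L \<leftarrow>l\<midarrow> K \<midarrow>r'\<rightarrow> R'\<close>, where \<open>(i', r', R')\<close> is a pushout of \<open>(I, i, r)\<close>.\<close>

definition is_associated_span :: "('o, 'm) weak_span \<Rightarrow> 'm \<Rightarrow> 'm \<Rightarrow> 'o \<Rightarrow> bool" where
  "is_associated_span \<rho> i' r' R' \<longleftrightarrow> is_pushout C i' r' R' (I_of \<rho>) (i_of \<rho>) (r_of \<rho>)"

text \<open>The pushout defining the associated span of \<open>\<rho>1\<close> is only determined up to isomorphism;
  sequential independence does not depend on its choice.\<close>

definition sequential_independent ::
  "('o, 'm) weak_span \<Rightarrow> ('o, 'm) transformation \<Rightarrow>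
   ('o, 'm) weak_span \<Rightarrow> ('o, 'm) transformation \<Rightarrow> bool" where
  "sequential_independent \<rho>1 \<gamma>1 \<rho>2 \<gamma>2 \<longleftrightarrow>
    (\<exists>i' r' R' n' j1 j2.
      is_associated_span \<rho>1 i' r' R' \<and>
      n' \<in> Hom C R' (H_of \<gamma>1) \<and> n' \<cdot> i' = n_of \<gamma>1 \<and> n' \<cdot> r' = g_of \<gamma>1 \<cdot> k_of \<gamma>1 \<and>
      j1 \<in> Hom C R' (D_of \<gamma>2) \<and> j2 \<in> Hom C (L_of \<rho>2) (D_of \<gamma>1) \<and>
      f_of \<gamma>2 \<cdot> j1 = n' \<and> g_of \<gamma>1 \<cdot> j2 = m_of \<gamma>2)"


section \<open>Parallel coherent transformations\<close>

definition is_parallel_coherent :: "'o \<Rightarrow> ('o, 'm) parallel_diagram \<Rightarrow> bool" where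
  "is_parallel_coherent G \<Gamma> \<longleftrightarrow> 1 \<le> size_of \<Gamma> \<and>
    (\<forall>a\<in>{1..size_of \<Gamma>}. is_weak_span (span_of \<Gamma> a) \<and>
      is_direct_transformation G (span_of \<Gamma> a) (trans_of \<Gamma> a) \<and>
      j_of \<Gamma> a a = k_of (trans_of \<Gamma> a) \<cdot> i_of (span_of \<Gamma> a)) \<and>
    (\<forall>a\<in>{1..size_of \<Gamma>}. \<forall>b\<in>{1..size_of \<Gamma>}.
      j_of \<Gamma> a b \<in> Hom C (I_of (span_of \<Gamma> a)) (D_of (trans_of \<Gamma> b)) \<and>
      f_of (trans_of \<Gamma> b) \<cdot> j_of \<Gamma> a b =
        f_of (trans_of \<Gamma> a) \<cdot> (k_of (trans_of \<Gamma> a) \<cdot> i_of (span_of \<Gamma> a)))"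

text \<open>\<open>G \<Longrightarrow> H\<close> by \<open>\<Gamma>\<close>. Each \<open>d c\<close> is uniquely determined because \<open>(L, e)\<close> is a limit.\<close>

definition parallel_coherent_transformation ::
  "'o \<Rightarrow> ('o, 'm) parallel_diagram \<Rightarrow> 'o \<Rightarrow> bool" where
  "parallel_coherent_transformation G \<Gamma> H \<longleftrightarrow> is_parallel_coherent G \<Gamma> \<and>
    (\<exists>L e d s t F h.
      is_limit C (size_of \<Gamma>) L e (\<lambda>a. f_of (trans_of \<Gamma> a)) G \<and>
      (\<forall>c\<in>{1..size_of \<Gamma>}. d c \<in> Hom C (I_of (span_of \<Gamma> c)) L \<and>
        (\<forall>a\<in>{1..size_of \<Gamma>}. j_of \<Gamma> c a = e a \<cdot> d c)) \<and>
      (\<forall>a\<in>{1..size_of \<Gamma>}.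
        is_pushout C (s a) (t a) (F a) (I_of (span_of \<Gamma> a)) (r_of (span_of \<Gamma> a)) (d a)) \<and>
      is_colimit C (size_of \<Gamma>) h H L s)"

definition pair_diagram ::
  "('o, 'm) weak_span \<Rightarrow> ('o, 'm) transformation \<Rightarrow>
   ('o, 'm) weak_span \<Rightarrow> ('o, 'm) transformation \<Rightarrow> 'm \<Rightarrow> 'm \<Rightarrow> ('o, 'm) parallel_diagram" where
  "pair_diagram \<rho>1 \<gamma>1 \<rho>2 \<gamma>2 j1 j2 =
    \<lparr> size_of = 2,
      span_of = (\<lambda>a. if a = 1 then \<rho>1 else \<rho>2),
      trans_of = (\<lambda>a. if a = 1 then \<gamma>1 else \<gamma>2),
      j_of = (\<lambda>a b.
        if a = 1 then (if b = 1 then k_of \<gamma>1 \<cdot> i_of \<rho>1 else j1 \<cdot> (l_of \<rho>1 \<cdot> i_of \<rho>1))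
        else (if b = 1 then j2 \<cdot> (l_of \<rho>2 \<cdot> i_of \<rho>2) else k_of \<gamma>2 \<cdot> i_of \<rho>2)) \<rparr>"

text \<open>\<open>G \<Longrightarrow> H\<close> by the diagram \<open>(\<gamma>1, \<gamma>2)\<close> of two parallel independent transformations.\<close>

definition pair_transformation ::
  "'o \<Rightarrow> ('o, 'm) weak_span \<Rightarrow> ('o, 'm) transformation \<Rightarrow>
   ('o, 'm) weak_span \<Rightarrow> ('o, 'm) transformation \<Rightarrow> 'o \<Rightarrow> bool" where
  "pair_transformation G \<rho>1 \<gamma>1 \<rho>2 \<gamma>2 H \<longleftrightarrow>
    (\<exists>j1 j2. parallel_independent_via \<rho>1 \<gamma>1 \<rho>2 \<gamma>2 j1 j2 \<and>
      parallel_coherent_transformation G (pair_diagram \<rho>1 \<gamma>1 \<rho>2 \<gamma>2 j1 j2) H)"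

end

end

theory Submission
  imports Defs
begin

text \<open>In an adhesive HLR category the weak double-pushouts of an object by an \<open>\<M>\<close>-weak span are
  determined up to isomorphism by their matches, because pushout complements along
  \<open>\<M>\<close>-morphisms are unique. The legs of \<open>G \<leftarrow> D\<^sub>1 \<rightarrow> H\<^sub>1\<close> are monic, so a match of \<open>L\<^sub>2\<close> in
  \<open>G\<close> and one in \<open>H\<^sub>1\<close> that factor through the same \<open>j\<^sub>2: L\<^sub>2 \<rightarrow> D\<^sub>1\<close> determine each other; this is
  all that is needed for the two correspondences to be mutually inverse up to isomorphism.
  For their existence, let \<open>P\<close> be the pullback of \<open>D\<^sub>1\<close> and \<open>D\<^sub>2\<close> over \<open>G\<close> (for the synthesis, of
  \<open>D\<^sub>1\<close> and \<open>D\<^sub>2'\<close> over \<open>H\<^sub>1\<close>). The Van Kampen property splits the given pushouts at \<open>P\<close>, and the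
  missing context object is obtained by gluing the other end of the associated span of \<open>\<rho>\<^sub>1\<close>
  to \<open>P\<close> along \<open>K\<^sub>1\<close>.\<close>

section \<open>Pushouts and pullbacks in a category\<close>

lemma atLeastAtMost_1_2: "{1..2} = {1, 2::nat}"
  by auto

context category
begin

section \<open>Typing and bracketing of composites\<close>

lemma Hom_unique:
  assumes "f \<in> Hom C A B" "f \<in> Hom C A' B'"
  shows "A' = A" "B' = B"
  using assms by (auto simp: Hom_def)

lemma Hom_Mor: "f \<in> Hom C A B \<Longrightarrow> f \<in> Mor C"
  by (simp add: Hom_def)

lemma Hom_Obj:
  assumes "f \<in> Hom C A B"
  shows "A \<in> Obj C" "B \<in> Obj C"
  using assms Dom_Obj Cod_Obj by (auto simp: Hom_def)

lemma Comp_simps: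
  assumes "f \<in> Mor C" "g \<in> Mor C" "Cod C f = Dom C g"
  shows "g \<cdot> f \<in> Mor C" "Dom C (g \<cdot> f) = Dom C f" "Cod C (g \<cdot> f) = Cod C g"
    "h \<in> Mor C \<Longrightarrow> Cod C g = Dom C h \<Longrightarrow> (h \<cdot> g) \<cdot> f = h \<cdot> (g \<cdot> f)"
  using assms Comp_Hom[of f "Dom C f" "Cod C f" g "Cod C g"]
    Comp_assoc[of f "Dom C f" "Cod C f" g "Cod C g" h "Cod C h"] by (auto simp: Hom_def)

lemma Id_simps:
  shows "A \<in> Obj C \<Longrightarrow> Id C A \<in> Mor C" "A \<in> Obj C \<Longrightarrow> Dom C (Id C A) = A"
    "A \<in> Obj C \<Longrightarrow> Cod C (Id C A) = A"
    "f \<in> Mor C \<Longrightarrow> Dom C f = A \<Longrightarrow> f \<cdot> Id C A = f"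
    "f \<in> Mor C \<Longrightarrow> Cod C f = A \<Longrightarrow> Id C A \<cdot> f = f"
  using Id_Hom[of A] Comp_Id_right[of f "Dom C f" "Cod C f"] Comp_Id_left[of f "Dom C f" "Cod C f"]
  by (auto simp: Hom_def)

text \<open>Unfolding \<open>Hom\<close> turns typing into equations on \<open>Dom\<close> and
  \<open>Cod\<close>, so composability is discharged by rewriting; composites are bracketed to the
  right.\<close>

lemmas cat_simps = Hom_def Comp_simps Id_simps

text \<open>In a right-bracketed composite, \<open>a \<cdot> b\<close> is no longer a subterm once
  it is preceded by some \<open>x\<close>; in this form the equation can still rewrite.\<close>

lemma Comp_reduce:
  assumes "a \<cdot> b = c" "a \<in> Mor C" "b \<in> Mor C" "Cod C b = Dom C a" "x \<in> Mor C" "Cod C x = Dom C b"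
  shows "a \<cdot> (b \<cdot> x) = c \<cdot> x"
  using assms Comp_simps(4)[of x b a] by simp

section \<open>Pushouts and their universal property\<close>

lemma pushoutI:
  assumes "r \<in> Hom C I R" "d \<in> Hom C I D" "g \<in> Hom C D H" "n \<in> Hom C R H" "g \<cdot> d = n \<cdot> r"
    and "\<And>X x y. x \<in> Hom C D X \<Longrightarrow> y \<in> Hom C R X \<Longrightarrow> x \<cdot> d = y \<cdot> r
      \<Longrightarrow> \<exists>u \<in> Hom C H X. u \<cdot> g = x \<and> u \<cdot> n = y"
    and "\<And>X u v. u \<in> Hom C H X \<Longrightarrow> v \<in> Hom C H X \<Longrightarrow> u \<cdot> g = v \<cdot> g \<Longrightarrow> u \<cdot> n = v \<cdot> n \<Longrightarrow> u = v"
  shows "is_pushout C g n H I r d"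
  unfolding is_pushout_def
proof (intro exI conjI allI ballI impI)
  fix X x y
  assume "x \<in> Hom C D X" "y \<in> Hom C R X" "x \<cdot> d = y \<cdot> r"
  then obtain u where u: "u \<in> Hom C H X" "u \<cdot> g = x" "u \<cdot> n = y"
    using assms(6) by blast
  show "\<exists>!u. u \<in> Hom C H X \<and> u \<cdot> g = x \<and> u \<cdot> n = y"
  proof (rule ex1I[of _ u])
    fix v assume "v \<in> Hom C H X \<and> v \<cdot> g = x \<and> v \<cdot> n = y"
    with u show "v = u" using assms(7)[of v X u] by simp
  qed (use u in simp)
qed (use assms in auto)

lemma pushout_homs:
  assumes "is_pushout C g n H I r d"
  obtains R D where "r \<in> Hom C I R" "d \<in> Hom C I D" "g \<in> Hom C D H" "n \<in> Hom C R H"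
  using assms unfolding is_pushout_def by blast

lemma pushout_Hom:
  assumes "is_pushout C g n H I r d"
  shows "d \<in> Hom C I' D \<Longrightarrow> g \<in> Hom C D H" "r \<in> Hom C I' R \<Longrightarrow> n \<in> Hom C R H"
  using assms by (auto simp: Hom_def elim!: pushout_homs)

lemma pushout_homs':
  assumes "is_pushout C g n H I r d" "d \<in> Hom C I' D"
  obtains R where "r \<in> Hom C I R" "g \<in> Hom C D H" "n \<in> Hom C R H" "I' = I"
  using assms by (auto simp: Hom_def elim!: pushout_homs)

lemma pushout_commute: "is_pushout C g n H I r d \<Longrightarrow> g \<cdot> d = n \<cdot> r"
  unfolding is_pushout_def by blast

lemma pushout_ex:
  assumes po: "is_pushout C g n H I r d"
    and d: "d \<in> Hom C I D" and r: "r \<in> Hom C I R"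
    and x: "x \<in> Hom C D X" and y: "y \<in> Hom C R X" and eq: "x \<cdot> d = y \<cdot> r"
  obtains u where "u \<in> Hom C H X" "u \<cdot> g = x" "u \<cdot> n = y"
proof -
  obtain R' D' where *: "r \<in> Hom C I R'" "d \<in> Hom C I D'"
    "\<forall>X. \<forall>x \<in> Hom C D' X. \<forall>y \<in> Hom C R' X. x \<cdot> d = y \<cdot> r \<longrightarrow>
        (\<exists>!u. u \<in> Hom C H X \<and> u \<cdot> g = x \<and> u \<cdot> n = y)"
    using po unfolding is_pushout_def by blast
  \<comment> \<open>The corners in \<open>is_pushout_def\<close> are bound existentially, but a
    morphism has a single domain and codomain, so they are the given ones.\<close>
  have "R' = R" "D' = D" using *(1,2) d r Hom_unique by metis+
  with *(3) x y eq have "\<exists>u. u \<in> Hom C H X \<and> u \<cdot> g = x \<and> u \<cdot> n = y" by blast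
  with that show ?thesis by blast
qed

text \<open>Both \<open>u\<close> and \<open>v\<close> mediate the cocone
  \<open>(v \<cdot> g, v \<cdot> n)\<close>, hence the legs of a pushout are jointly epic.\<close>

lemma pushout_eq:
  assumes po: "is_pushout C g n H I r d"
    and u: "u \<in> Hom C H X" and v: "v \<in> Hom C H X"
    and eq: "u \<cdot> g = v \<cdot> g" "u \<cdot> n = v \<cdot> n"
  shows "u = v"
proof -
  obtain R D where *: "r \<in> Hom C I R" "d \<in> Hom C I D" "g \<in> Hom C D H" "n \<in> Hom C R H" "g \<cdot> d = n \<cdot> r"
    "\<forall>X. \<forall>x \<in> Hom C D X. \<forall>y \<in> Hom C R X. x \<cdot> d = y \<cdot> r \<longrightarrow>
        (\<exists>!u. u \<in> Hom C H X \<and> u \<cdot> g = x \<and> u \<cdot> n = y)"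
    using po unfolding is_pushout_def by blast
  have "v \<cdot> g \<in> Hom C D X" "v \<cdot> n \<in> Hom C R X"
    using *(3,4) v Comp_Hom by blast+
  moreover have "(v \<cdot> g) \<cdot> d = (v \<cdot> n) \<cdot> r"
    using Comp_assoc[OF *(2,3) v] Comp_assoc[OF *(1,4) v] *(5) by simp
  ultimately have "\<exists>!w. w \<in> Hom C H X \<and> w \<cdot> g = v \<cdot> g \<and> w \<cdot> n = v \<cdot> n"
    using *(6) by blast
  with u v eq show ?thesis by blast
qed

lemma pushout_sym:
  assumes "is_pushout C g n H I r d"
  shows "is_pushout C n g H I d r"
  using assms unfolding is_pushout_def by (metis (no_types, lifting))

text \<open>Parallel coherent transformations are defined by indexed limits and colimits, whereas
  the Van Kampen property speaks of squares; this equivalence and its dual pass between the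
  two.\<close>

lemma pullback_iff_limit:
  "is_pullback C L (e 1) (e 2) (f 1) (f 2) G \<longleftrightarrow> is_limit C 2 L e f G"
proof
  assume "is_pullback C L (e 1) (e 2) (f 1) (f 2) G"
  then obtain A B where *: "f 1 \<in> Hom C A G" "f 2 \<in> Hom C B G" "e 1 \<in> Hom C L A" "e 2 \<in> Hom C L B"
    "f 1 \<cdot> e 1 = f 2 \<cdot> e 2"
    "\<And>X x y. x \<in> Hom C X A \<Longrightarrow> y \<in> Hom C X B \<Longrightarrow> f 1 \<cdot> x = f 2 \<cdot> y
      \<Longrightarrow> \<exists>!u. u \<in> Hom C X L \<and> e 1 \<cdot> u = x \<and> e 2 \<cdot> u = y"
    unfolding is_pullback_def by blast
  have D: "Dom C (f 1) = A" "Dom C (f 2) = B" "Cod C (f 1) = G" "Cod C (f 2) = G"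
    using *(1-4) by (auto simp: Hom_def)
  show "is_limit C 2 L e f G"
    unfolding is_limit_def atLeastAtMost_1_2
  proof (intro conjI allI impI)
    fix X x
    assume "X \<in> Obj C \<and> (\<forall>a\<in>{1, 2}. x a \<in> Hom C X (Dom C (f a))) \<and>
      (\<forall>a\<in>{1, 2}. \<forall>b\<in>{1, 2}. f a \<cdot> x a = f b \<cdot> x b)"
    then have "x 1 \<in> Hom C X (Dom C (f 1))" "x 2 \<in> Hom C X (Dom C (f 2))" "f 1 \<cdot> x 1 = f 2 \<cdot> x 2"
      by blast+
    then have "x 1 \<in> Hom C X A" "x 2 \<in> Hom C X B" "f 1 \<cdot> x 1 = f 2 \<cdot> x 2"
      using D by simp_all
    note ex = *(6)[OF this]
    have "(\<forall>a\<in>{1, 2}. x a = e a \<cdot> u) \<longleftrightarrow> e 1 \<cdot> u = x 1 \<and> e 2 \<cdot> u = x 2" for u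
      by auto
    with ex show "\<exists>!u. u \<in> Hom C X L \<and> (\<forall>a\<in>{1, 2}. x a = e a \<cdot> u)"
      by simp
  qed (use *(1-5) D Hom_Obj[OF *(1)] Hom_Obj[OF *(3)] in \<open>auto simp: Hom_Mor\<close>)
next
  assume L: "is_limit C 2 L e f G"
  then have fe: "\<forall>a\<in>{1, 2}. f a \<in> Mor C \<and> Cod C (f a) = G \<and> e a \<in> Hom C L (Dom C (f a))"
    unfolding is_limit_def atLeastAtMost_1_2 by blast
  from fe have *: "f 1 \<in> Hom C (Dom C (f 1)) G" "f 2 \<in> Hom C (Dom C (f 2)) G"
    "e 1 \<in> Hom C L (Dom C (f 1))" "e 2 \<in> Hom C L (Dom C (f 2))"
    by (simp_all add: Hom_def)
  have eq: "f 1 \<cdot> e 1 = f 2 \<cdot> e 2"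
    using L unfolding is_limit_def atLeastAtMost_1_2 by blast
  show "is_pullback C L (e 1) (e 2) (f 1) (f 2) G"
    unfolding is_pullback_def
  proof (intro exI conjI allI ballI impI)
    fix X x y
    assume a: "x \<in> Hom C X (Dom C (f 1))" "y \<in> Hom C X (Dom C (f 2))" "f 1 \<cdot> x = f 2 \<cdot> y"
    \<comment> \<open>The pair becomes a family on \<open>{1, 2}\<close>; its value \<open>y\<close>
      at every other index is never inspected.\<close>
    define z where "z = (\<lambda>a::nat. if a = 1 then x else y)"
    have "X \<in> Obj C \<and> (\<forall>a\<in>{1, 2}. z a \<in> Hom C X (Dom C (f a))) \<and>
      (\<forall>a\<in>{1, 2}. \<forall>b\<in>{1, 2}. f a \<cdot> z a = f b \<cdot> z b)"
      using a Hom_Obj[OF a(1)] by (auto simp: z_def)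
    then have "\<exists>!u. u \<in> Hom C X L \<and> (\<forall>a\<in>{1, 2}. z a = e a \<cdot> u)"
      using L unfolding is_limit_def atLeastAtMost_1_2 by blast
    moreover have "(\<forall>a\<in>{1, 2}. z a = e a \<cdot> u) \<longleftrightarrow> e 1 \<cdot> u = x \<and> e 2 \<cdot> u = y" for u
      by (auto simp: z_def)
    ultimately show "\<exists>!u. u \<in> Hom C X L \<and> e 1 \<cdot> u = x \<and> e 2 \<cdot> u = y"
      by simp
  qed (use * eq in auto)
qed

text \<open>Here \<open>s 2\<close> precedes \<open>s 1\<close> because \<open>is_pushout\<close>
  pairs its first leg with the opposite morphism of the span, and \<open>h 1\<close> starts where
  \<open>s 1\<close> ends.\<close>

lemma pushout_iff_colimit:
  "is_pushout C (h 1) (h 2) H L (s 2) (s 1) \<longleftrightarrow> is_colimit C 2 h H L s"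
proof
  assume "is_pushout C (h 1) (h 2) H L (s 2) (s 1)"
  then obtain A B where *: "s 1 \<in> Hom C L A" "s 2 \<in> Hom C L B" "h 1 \<in> Hom C A H" "h 2 \<in> Hom C B H"
    "h 1 \<cdot> s 1 = h 2 \<cdot> s 2"
    "\<And>X x y. x \<in> Hom C A X \<Longrightarrow> y \<in> Hom C B X \<Longrightarrow> x \<cdot> s 1 = y \<cdot> s 2
      \<Longrightarrow> \<exists>!u. u \<in> Hom C H X \<and> u \<cdot> h 1 = x \<and> u \<cdot> h 2 = y"
    unfolding is_pushout_def by blast
  have D: "Cod C (s 1) = A" "Cod C (s 2) = B" "Dom C (s 1) = L" "Dom C (s 2) = L"
    using *(1-4) by (auto simp: Hom_def)
  show "is_colimit C 2 h H L s"
    unfolding is_colimit_def atLeastAtMost_1_2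
  proof (intro conjI allI impI)
    fix X x
    assume "X \<in> Obj C \<and> (\<forall>a\<in>{1, 2}. x a \<in> Hom C (Cod C (s a)) X) \<and>
      (\<forall>a\<in>{1, 2}. \<forall>b\<in>{1, 2}. x a \<cdot> s a = x b \<cdot> s b)"
    then have "x 1 \<in> Hom C (Cod C (s 1)) X" "x 2 \<in> Hom C (Cod C (s 2)) X" "x 1 \<cdot> s 1 = x 2 \<cdot> s 2"
      by blast+
    then have "x 1 \<in> Hom C A X" "x 2 \<in> Hom C B X" "x 1 \<cdot> s 1 = x 2 \<cdot> s 2"
      using D by simp_all
    note ex = *(6)[OF this]
    have "(\<forall>a\<in>{1, 2}. x a = u \<cdot> h a) \<longleftrightarrow> u \<cdot> h 1 = x 1 \<and> u \<cdot> h 2 = x 2" for u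
      by auto
    with ex show "\<exists>!u. u \<in> Hom C H X \<and> (\<forall>a\<in>{1, 2}. x a = u \<cdot> h a)"
      by simp
  qed (use *(1-5) D Hom_Obj[OF *(1)] Hom_Obj[OF *(3)] in \<open>auto simp: Hom_Mor\<close>)
next
  assume L: "is_colimit C 2 h H L s"
  then have sh: "\<forall>a\<in>{1, 2}. s a \<in> Mor C \<and> Dom C (s a) = L \<and> h a \<in> Hom C (Cod C (s a)) H"
    unfolding is_colimit_def atLeastAtMost_1_2 by blast
  from sh have *: "s 1 \<in> Hom C L (Cod C (s 1))" "s 2 \<in> Hom C L (Cod C (s 2))"
    "h 1 \<in> Hom C (Cod C (s 1)) H" "h 2 \<in> Hom C (Cod C (s 2)) H"
    by (simp_all add: Hom_def)
  have eq: "h 1 \<cdot> s 1 = h 2 \<cdot> s 2"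
    using L unfolding is_colimit_def atLeastAtMost_1_2 by blast
  show "is_pushout C (h 1) (h 2) H L (s 2) (s 1)"
    unfolding is_pushout_def
  proof (intro exI conjI allI ballI impI)
    fix X x y
    assume a: "x \<in> Hom C (Cod C (s 1)) X" "y \<in> Hom C (Cod C (s 2)) X" "x \<cdot> s 1 = y \<cdot> s 2"
    define z where "z = (\<lambda>a::nat. if a = 1 then x else y)"
    have "X \<in> Obj C \<and> (\<forall>a\<in>{1, 2}. z a \<in> Hom C (Cod C (s a)) X) \<and>
      (\<forall>a\<in>{1, 2}. \<forall>b\<in>{1, 2}. z a \<cdot> s a = z b \<cdot> s b)"
      using a Hom_Obj[OF a(1)] by (auto simp: z_def)
    then have "\<exists>!u. u \<in> Hom C H X \<and> (\<forall>a\<in>{1, 2}. z a = u \<cdot> h a)"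
      using L unfolding is_colimit_def atLeastAtMost_1_2 by blast
    moreover have "(\<forall>a\<in>{1, 2}. z a = u \<cdot> h a) \<longleftrightarrow> u \<cdot> h 1 = x \<and> u \<cdot> h 2 = y" for u
      by (auto simp: z_def)
    ultimately show "\<exists>!u. u \<in> Hom C H X \<and> u \<cdot> h 1 = x \<and> u \<cdot> h 2 = y"
      by simp
  qed (use * eq in auto)
qed

text \<open>A cocone \<open>(x, y)\<close> on the rectangle is extended in two stages:
  \<open>(x \<cdot> d', y)\<close> mediates through \<open>H\<close>, and the result together with
  \<open>x\<close> mediates through \<open>H'\<close>.\<close>

lemma pushout_paste:
  assumes 1: "is_pushout C g n H I r d" and 2: "is_pushout C g' n' H' D g d'"
  shows "is_pushout C g' (n' \<cdot> n) H' I r (d' \<cdot> d)"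
proof -
  obtain R where r: "r \<in> Hom C I R" and d: "d \<in> Hom C I D" and g: "g \<in> Hom C D H"
    and n: "n \<in> Hom C R H" and n': "n' \<in> Hom C H H'"
    using 1 2 by (auto simp: Hom_def elim!: pushout_homs)
  obtain D' where d': "d' \<in> Hom C D D'" and g': "g' \<in> Hom C D' H'"
    using 2 by (elim pushout_homs)
  show ?thesis
  proof (rule pushoutI)
    show "r \<in> Hom C I R" "d' \<cdot> d \<in> Hom C I D'" "g' \<in> Hom C D' H'" "n' \<cdot> n \<in> Hom C R H'"
      using r d d' g' n n' Comp_Hom by blast+
    show "g' \<cdot> (d' \<cdot> d) = n' \<cdot> n \<cdot> r"
      using r d g n n' d' g' pushout_commute[OF 1, symmetric]
      by (simp add: cat_simps Comp_reduce[OF pushout_commute[OF 2]])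
  next
    fix X x y
    assume x: "x \<in> Hom C D' X" and y: "y \<in> Hom C R X" and eq: "x \<cdot> (d' \<cdot> d) = y \<cdot> r"
    have "x \<cdot> d' \<in> Hom C D X" "(x \<cdot> d') \<cdot> d = y \<cdot> r"
      using x d' d eq by (simp_all add: cat_simps)
    from pushout_ex[OF 1 d r this(1) y this(2)]
    obtain u where u: "u \<in> Hom C H X" "u \<cdot> g = x \<cdot> d'" "u \<cdot> n = y" .
    from pushout_ex[OF 2 d' g x u(1) u(2)[symmetric]]
    obtain w where w: "w \<in> Hom C H' X" "w \<cdot> g' = x" "w \<cdot> n' = u" .
    then show "\<exists>u\<in>Hom C H' X. u \<cdot> g' = x \<and> u \<cdot> (n' \<cdot> n) = y"
      using u Comp_assoc[OF n n' w(1)] by auto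
  next
    fix X u v
    assume u: "u \<in> Hom C H' X" and v: "v \<in> Hom C H' X" and eq: "u \<cdot> g' = v \<cdot> g'"
      and eq2: "u \<cdot> (n' \<cdot> n) = v \<cdot> (n' \<cdot> n)"
    have "u \<cdot> n' = v \<cdot> n'"
    proof (rule pushout_eq[OF 1])
      show "u \<cdot> n' \<in> Hom C H X" "v \<cdot> n' \<in> Hom C H X" using u v n' Comp_Hom by blast+
      show "u \<cdot> n' \<cdot> g = v \<cdot> n' \<cdot> g"
        using d' g g' n' u v
        by (simp add: cat_simps pushout_commute[OF 2, symmetric] Comp_reduce[OF eq])
      show "u \<cdot> n' \<cdot> n = v \<cdot> n' \<cdot> n"
        using n n' u v eq2 by (simp add: cat_simps)
    qed
    then show "u = v" using pushout_eq[OF 2 u v eq] by simp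
  qed
qed

text \<open>A cocone on the second square becomes one on the rectangle by composing with
  \<open>n\<close>; the mediating morphism fits because the legs into \<open>H\<close> are jointly
  epic. Below, this is how a given pushout is split at an intermediate object.\<close>

lemma pushout_cancel:
  assumes 1: "is_pushout C g n H I r d" and 2: "is_pushout C g' (n' \<cdot> n) H' I r (d' \<cdot> d)"
    and n': "n' \<in> Hom C H H'" and d': "d' \<in> Hom C D D'" and d: "d \<in> Hom C I D"
    and eq: "n' \<cdot> g = g' \<cdot> d'"
  shows "is_pushout C g' n' H' D g d'"
proof -
  obtain R where r: "r \<in> Hom C I R" and g: "g \<in> Hom C D H" and n: "n \<in> Hom C R H"
    using pushout_homs'[OF 1 d] .
  have d'd: "d' \<cdot> d \<in> Hom C I D'" using d d' Comp_Hom by blast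
  have g': "g' \<in> Hom C D' H'" using pushout_Hom[OF 2] d'd by blast
  show ?thesis
  proof (rule pushoutI)
    fix X x y
    assume x: "x \<in> Hom C D' X" and y: "y \<in> Hom C H X" and xy: "x \<cdot> d' = y \<cdot> g"
    have "x \<cdot> (d' \<cdot> d) = (y \<cdot> n) \<cdot> r"
      using x y d d' g n r
      by (simp add: cat_simps Comp_reduce[OF xy] pushout_commute[OF 1])
    from pushout_ex[OF 2 d'd r x Comp_Hom[OF n y] this]
    obtain u where u: "u \<in> Hom C H' X" "u \<cdot> g' = x" "u \<cdot> (n' \<cdot> n) = y \<cdot> n" .
    have "u \<cdot> n' = y"
    proof (rule pushout_eq[OF 1])
      show "u \<cdot> n' \<in> Hom C H X" "y \<in> Hom C H X" using u n' y Comp_Hom by blast+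
      show "u \<cdot> n' \<cdot> g = y \<cdot> g" using u xy g n' g' d'
        by (simp add: cat_simps eq Comp_reduce[OF u(2)])
      show "u \<cdot> n' \<cdot> n = y \<cdot> n" using u n n' by (simp add: cat_simps)
    qed
    with u show "\<exists>u\<in>Hom C H' X. u \<cdot> g' = x \<and> u \<cdot> n' = y" by blast
  next
    fix X u v
    assume u: "u \<in> Hom C H' X" and v: "v \<in> Hom C H' X" and e: "u \<cdot> g' = v \<cdot> g'" "u \<cdot> n' = v \<cdot> n'"
    have "u \<cdot> (n' \<cdot> n) = v \<cdot> (n' \<cdot> n)"
      using u v n n' by (simp add: cat_simps Comp_reduce[OF e(2)])
    with pushout_eq[OF 2 u v e(1)] show "u = v" by simp
  qed (use g g' n' d' eq in auto)
qed

section \<open>Isomorphisms and trivial pushouts\<close>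

lemma isoE:
  assumes "is_iso C f" "f \<in> Hom C X Y"
  obtains g where "g \<in> Hom C Y X" "g \<cdot> f = Id C X" "f \<cdot> g = Id C Y"
  using assms unfolding is_iso_def Hom_def by auto

lemma isoI:
  assumes "f \<in> Hom C X Y" "g \<in> Hom C Y X" "g \<cdot> f = Id C X" "f \<cdot> g = Id C Y"
  shows "is_iso C f"
  using assms unfolding is_iso_def Hom_def by auto

lemma iso_comp:
  assumes f: "f \<in> Hom C X Y" "is_iso C f" and g: "g \<in> Hom C Y Z" "is_iso C g"
  shows "is_iso C (g \<cdot> f)"
proof -
  obtain f' where f': "f' \<in> Hom C Y X" "f' \<cdot> f = Id C X" "f \<cdot> f' = Id C Y"
    using isoE[OF f(2,1)] .
  obtain g' where g': "g' \<in> Hom C Z Y" "g' \<cdot> g = Id C Y" "g \<cdot> g' = Id C Z"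
    using isoE[OF g(2,1)] .
  show ?thesis
  proof (rule isoI)
    show "g \<cdot> f \<in> Hom C X Z" "f' \<cdot> g' \<in> Hom C Z X" using f g f' g' Comp_Hom by blast+
    show "f' \<cdot> g' \<cdot> (g \<cdot> f) = Id C X"
      using f(1) g(1) f'(1,2) g'(1) by (simp add: cat_simps Comp_reduce[OF g'(2)])
    show "g \<cdot> f \<cdot> (f' \<cdot> g') = Id C Z"
      using f(1) g(1) f'(1) g'(1,3) by (simp add: cat_simps Comp_reduce[OF f'(3)])
  qed
qed

lemma Id_iso: "A \<in> Obj C \<Longrightarrow> is_iso C (Id C A)"
  by (rule isoI[where g = "Id C A"]) (auto simp: cat_simps)

lemma Id_mono: "A \<in> Obj C \<Longrightarrow> is_mono C (Id C A)"
  by (auto simp: is_mono_def cat_simps)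

lemma pushout_iso:
  assumes po: "is_pushout C g n H I r d" and iso: "is_iso C r"
  shows "is_iso C g"
proof -
  obtain R D where r: "r \<in> Hom C I R" and d: "d \<in> Hom C I D" and g: "g \<in> Hom C D H"
    and n: "n \<in> Hom C R H"
    using po by (elim pushout_homs)
  obtain v where v: "v \<in> Hom C R I" "v \<cdot> r = Id C I" "r \<cdot> v = Id C R"
    using isoE[OF iso r] .
  have D: "Id C D \<in> Hom C D D" using Hom_Obj[OF d] Id_Hom by blast
  \<comment> \<open>The inverse of \<open>g\<close> will be the mediating morphism of the cocone
    \<open>(Id C D, d \<cdot> v)\<close>.\<close>
  have "Id C D \<cdot> d = (d \<cdot> v) \<cdot> r"
    using d r v(1) Hom_Obj[OF d] by (simp add: cat_simps v(2))
  from pushout_ex[OF po d r D Comp_Hom[OF v(1) d] this]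
  obtain u where u: "u \<in> Hom C H D" "u \<cdot> g = Id C D" "u \<cdot> n = d \<cdot> v" .
  have "g \<cdot> u = Id C H"
  proof (rule pushout_eq[OF po])
    show "g \<cdot> u \<in> Hom C H H" "Id C H \<in> Hom C H H"
      using g u Id_Hom Hom_Obj(2)[OF g] Comp_Hom by blast+
    show "g \<cdot> u \<cdot> g = Id C H \<cdot> g"
      using u g Hom_Obj[OF g] by (simp add: cat_simps)
    show "g \<cdot> u \<cdot> n = Id C H \<cdot> n"
      using u(1) g n r d v(1) Hom_Obj[OF n]
      by (simp add: cat_simps u(3) v(3) Comp_reduce[OF pushout_commute[OF po]])
  qed
  with u g show ?thesis by (intro isoI)
qed

text \<open>This trivial square is the top face of the cube showing that pushouts along
  \<open>M\<close> are pullbacks.\<close>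

lemma pushout_Id:
  assumes d: "d \<in> Hom C I D"
  shows "is_pushout C (Id C D) d D I (Id C I) d"
proof (rule pushoutI)
  show "Id C I \<in> Hom C I I" "Id C D \<in> Hom C D D" using Id_Hom Hom_Obj[OF d] by blast+
  show "Id C D \<cdot> d = d \<cdot> Id C I" using d Hom_Obj[OF d] by (simp add: cat_simps)
next
  fix X x y
  assume "x \<in> Hom C D X" "y \<in> Hom C I X" "x \<cdot> d = y \<cdot> Id C I"
  then have "x \<in> Hom C D X \<and> x \<cdot> Id C D = x \<and> x \<cdot> d = y"
    using Hom_Obj[OF d] by (simp add: cat_simps)
  then show "\<exists>u\<in>Hom C D X. u \<cdot> Id C D = x \<and> u \<cdot> d = y" by blast
next
  fix X u v
  assume "u \<in> Hom C D X" "v \<in> Hom C D X" "u \<cdot> Id C D = v \<cdot> Id C D"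
  then show "u = v" using Hom_Obj[OF d] by (simp add: cat_simps)
qed (use d in auto)

section \<open>Pullbacks and monomorphisms\<close>

lemma pullback_homs:
  assumes "is_pullback C P p q f g Z"
  obtains A B where "f \<in> Hom C A Z" "g \<in> Hom C B Z" "p \<in> Hom C P A" "q \<in> Hom C P B"
  using assms unfolding is_pullback_def by blast

lemma pullback_Hom:
  assumes "is_pullback C P p q f g Z"
  shows "f \<in> Hom C A Z' \<Longrightarrow> p \<in> Hom C P A" "g \<in> Hom C B Z' \<Longrightarrow> q \<in> Hom C P B"
  using assms by (auto simp: Hom_def elim!: pullback_homs)

lemma pullback_commute: "is_pullback C P p q f g Z \<Longrightarrow> f \<cdot> p = g \<cdot> q"
  unfolding is_pullback_def by blast

lemma pullback_sym:
  assumes "is_pullback C P p q f g Z"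
  shows "is_pullback C P q p g f Z"
  using assms unfolding is_pullback_def by (metis (no_types, lifting))

lemma pullback_ex1:
  assumes pb: "is_pullback C P p q f g Z"
    and f: "f \<in> Hom C A Z" and g: "g \<in> Hom C B Z"
    and x: "x \<in> Hom C X A" and y: "y \<in> Hom C X B" and eq: "f \<cdot> x = g \<cdot> y"
  shows "\<exists>!u. u \<in> Hom C X P \<and> p \<cdot> u = x \<and> q \<cdot> u = y"
proof -
  obtain A' B' where *: "f \<in> Hom C A' Z" "g \<in> Hom C B' Z"
    "\<forall>X. \<forall>x \<in> Hom C X A'. \<forall>y \<in> Hom C X B'. f \<cdot> x = g \<cdot> y \<longrightarrow>
        (\<exists>!u. u \<in> Hom C X P \<and> p \<cdot> u = x \<and> q \<cdot> u = y)"
    using pb unfolding is_pullback_def by blast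
  have "A' = A" "B' = B" using *(1,2) f g Hom_unique by metis+
  with *(3) x y eq show ?thesis by blast
qed

lemma monoD:
  assumes "is_mono C f" "f \<in> Hom C Y Z" "x \<in> Hom C X Y" "y \<in> Hom C X Y" "f \<cdot> x = f \<cdot> y"
  shows "x = y"
  using assms unfolding is_mono_def Hom_def by auto

text \<open>A morphism that already factors through a mono is unchanged by pulling back along it.
  The cubes below take their degenerate faces from the cases where \<open>x\<close> or
  \<open>f\<close> is an identity, or where a vertical morphism is a mono.\<close>

lemma pullback_mono_factor:
  assumes x: "x \<in> Hom C A B" and f: "f \<in> Hom C B Z" and "is_mono C f"
  shows "is_pullback C A (Id C A) x (f \<cdot> x) f Z"
  unfolding is_pullback_def
proof (intro exI conjI allI ballI impI)
  have A: "Id C A \<in> Hom C A A" using Id_Hom Hom_Obj[OF x] by blast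
  have fx: "f \<cdot> x \<in> Hom C A Z" using x f Comp_Hom by blast
  show "f \<cdot> x \<in> Hom C A Z" "f \<in> Hom C B Z" "Id C A \<in> Hom C A A" "x \<in> Hom C A B" by fact+
  show "f \<cdot> x \<cdot> Id C A = f \<cdot> x" using Comp_Id_right[OF fx] .
  fix X y z
  assume y: "y \<in> Hom C X A" and z: "z \<in> Hom C X B" and eq: "f \<cdot> x \<cdot> y = f \<cdot> z"
  have "f \<cdot> (x \<cdot> y) = f \<cdot> z" using eq Comp_assoc[OF y x f] by simp
  then have "x \<cdot> y = z" using monoD[OF assms(3) f _ z] Comp_Hom[OF y x] by blast
  then show "\<exists>!u. u \<in> Hom C X A \<and> Id C A \<cdot> u = y \<and> x \<cdot> u = z"
    using y by (auto simp: cat_simps)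
qed

end

section \<open>Consequences of the Van Kampen property\<close>

context adhesive_hlr
begin

text \<open>With all eight corners named instead of written as \<open>Dom C f\<close> or
  \<open>Cod C v\<close>, a cube can be supplied by listing its edges and back faces.\<close>

lemma van_Kampen_iff:
  assumes "is_pushout C w v Z W f g" "f \<in> M \<or> g \<in> M"
    and "f \<in> Hom C W X" "g \<in> Hom C W Y" "v \<in> Hom C X Z" "w \<in> Hom C Y Z"
    and "f' \<in> Hom C W' X'" "g' \<in> Hom C W' Y'" "v' \<in> Hom C X' Z'" "w' \<in> Hom C Y' Z'"
    and "a \<in> Hom C W' W" "b \<in> Hom C X' X" "c \<in> Hom C Y' Y" "d \<in> Hom C Z' Z"
    and "v' \<cdot> f' = w' \<cdot> g'" "v \<cdot> b = d \<cdot> v'" "w \<cdot> c = d \<cdot> w'"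
    and "is_pullback C W' a f' f b X" "is_pullback C W' a g' g c Y"
  shows "is_pushout C w' v' Z' W' f' g' \<longleftrightarrow>
    is_pullback C X' b v' v d Z \<and> is_pullback C Y' c w' w d Z"
proof -
  have eqs: "Dom C f = W" "Cod C f = X" "Cod C g = Y" "Cod C v = Z" "Cod C w = Z"
    using assms(3-6) by (auto simp: Hom_def)
  show ?thesis
    by (rule M_van_Kampen[OF assms(1,2), unfolded van_Kampen_def eqs, rule_format, where a = a])
      (intro conjI assms(7-))
qed

text \<open>Take the cube over the given square with vertical morphisms \<open>Id C I\<close>,
  \<open>r\<close>, \<open>Id C D\<close> and \<open>g\<close>. Its top is the trivial pushout of
  \<open>d\<close> along \<open>Id C I\<close>, so its front faces are pullbacks, and one of them is
  the given square.\<close>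

lemma pushout_along_M_is_pullback:
  assumes po: "is_pushout C g n H I r d" and rM: "r \<in> M"
  shows "is_pullback C I r d n g H"
proof -
  obtain R D where r: "r \<in> Hom C I R" and d: "d \<in> Hom C I D" and g: "g \<in> Hom C D H"
    and n: "n \<in> Hom C R H"
    using po by (elim pushout_homs)
  have I: "I \<in> Obj C" and D: "D \<in> Obj C" using Hom_Obj[OF d] by auto
  have 1: "is_pullback C I (Id C I) (Id C I) r r R"
    using pullback_mono_factor[OF Id_Hom[OF I] r M_mono[OF rM]] r I by (simp add: cat_simps)
  have 2: "is_pullback C I (Id C I) d d (Id C D) D"
    using pullback_mono_factor[OF d Id_Hom[OF D] Id_mono[OF D]] d D by (simp add: cat_simps)
  have "d \<cdot> Id C I = Id C D \<cdot> d" "g \<cdot> Id C D = g \<cdot> Id C D"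
    using d I D by (simp_all add: cat_simps)
  from van_Kampen_iff[OF po disjI1[OF rM] r d n g Id_Hom[OF I] d d Id_Hom[OF D]
      Id_Hom[OF I] r Id_Hom[OF D] g this(1) pushout_commute[OF po, symmetric] this(2) 1 2]
  show ?thesis using pushout_Id[OF d] by simp
qed

text \<open>Pull the pushout back along \<open>f'\<close>. Since \<open>m\<close> and
  \<open>f \<cdot> k\<close> factor through this mono, \<open>L\<close> and \<open>K\<close> stay as
  they are while \<open>D\<close> becomes \<open>P\<close>. The Van Kampen property makes the top
  face a pushout; cancelling it from the given pushout leaves the square of \<open>P\<close>,
  \<open>D\<close>, \<open>D'\<close> and \<open>G\<close>.\<close>

lemma pushout_pullback_decomposition:
  assumes po: "is_pushout C f m G K l k" and lM: "l \<in> M"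
    and pb: "is_pullback C P e e' f f' G" and f'M: "f' \<in> M"
    and l: "l \<in> Hom C K L" and k: "k \<in> Hom C K D" and f': "f' \<in> Hom C D' G"
    and j: "j \<in> Hom C L D'" and jm: "f' \<cdot> j = m"
  obtains d where "d \<in> Hom C K P" "e \<cdot> d = k" "e' \<cdot> d = j \<cdot> l"
    "is_pushout C e' j D' K l d" "is_pushout C f f' G P e' e"
proof -
  have f: "f \<in> Hom C D G" and m: "m \<in> Hom C L G" using pushout_Hom[OF po] l k by blast+
  have e: "e \<in> Hom C P D" and e': "e' \<in> Hom C P D'" using pullback_Hom[OF pb] f f' by blast+
  have eM: "e \<in> M" using M_pullback_closed[OF pb] f'M by blast
  have "f \<cdot> k = f' \<cdot> (j \<cdot> l)"
    using pushout_commute[OF po] l j f' by (simp add: cat_simps Comp_reduce[OF jm])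
  from pullback_ex1[OF pb f f' k Comp_Hom[OF l j] this]
  obtain d where d: "d \<in> Hom C K P" "e \<cdot> d = k" "e' \<cdot> d = j \<cdot> l" by blast
  have L: "L \<in> Obj C" and K: "K \<in> Obj C" using Hom_Obj[OF l] by auto
  have 1: "is_pullback C K (Id C K) l l (Id C L) L"
    using pullback_mono_factor[OF l Id_Hom[OF L] Id_mono[OF L]] l L by (simp add: cat_simps)
  have 2: "is_pullback C K (Id C K) d k e D"
    using pullback_mono_factor[OF d(1) e M_mono[OF eM]] d(2) by simp
  have 3: "is_pullback C L (Id C L) j m f' G"
    using pullback_mono_factor[OF j f' M_mono[OF f'M]] jm by simp
  have "m \<cdot> Id C L = f' \<cdot> j" using m L jm by (simp add: cat_simps)
  from van_Kampen_iff[OF po disjI1[OF lM] l k m f l d(1) j e'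
      Id_Hom[OF K] Id_Hom[OF L] e f' d(3)[symmetric] this pullback_commute[OF pb] 1 2]
  have po1: "is_pushout C e' j D' K l d" using 3 pb by simp
  have "is_pushout C f (f' \<cdot> j) G K l (e \<cdot> d)" using po d(2) jm by simp
  from pushout_cancel[OF po1 this f' e d(1) pullback_commute[OF pb, symmetric]]
  show ?thesis using that d po1 by blast
qed

text \<open>In the cube over \<open>po\<close> with vertical morphisms \<open>Id C K\<close>,
  \<open>l\<close>, \<open>p\<close> and \<open>f'\<close>, the front faces are \<open>pb\<close>
  and the second pushout, read as a pullback. Hence \<open>q\<close> is opposite to
  \<open>Id C K\<close> in the top pushout.\<close>

lemma pushout_complement_projection_iso:
  assumes po: "is_pushout C f m G K l k" and po': "is_pushout C f' m G K l k'" and lM: "l \<in> M"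
    and pb: "is_pullback C P p q f f' G" and x: "x \<in> Hom C K P" "p \<cdot> x = k" "q \<cdot> x = k'"
  shows "is_iso C q"
proof -
  obtain L D where l: "l \<in> Hom C K L" and k: "k \<in> Hom C K D" and f: "f \<in> Hom C D G"
    and m: "m \<in> Hom C L G" using po by (elim pushout_homs)
  obtain D' where k': "k' \<in> Hom C K D'" and f': "f' \<in> Hom C D' G"
    using po' by (elim pushout_homs)
  have p: "p \<in> Hom C P D" and q: "q \<in> Hom C P D'" using pullback_Hom[OF pb] f f' by blast+
  have pM: "p \<in> M" using M_pullback_closed[OF pb] M_pushout_closed[OF po'] lM by blast
  have K: "K \<in> Obj C" using Hom_Obj[OF l] by auto
  have 1: "is_pullback C K (Id C K) (Id C K) l l L"
    using pullback_mono_factor[OF Id_Hom[OF K] l M_mono[OF lM]] l K by (simp add: cat_simps)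
  have 2: "is_pullback C K (Id C K) x k p D"
    using pullback_mono_factor[OF x(1) p M_mono[OF pM]] x by simp
  have "k' \<cdot> Id C K = q \<cdot> x" using k' K x by (simp add: cat_simps)
  from van_Kampen_iff[OF po disjI1[OF lM] l k m f Id_Hom[OF K] x(1) k' q
      Id_Hom[OF K] l p f' this pushout_commute[OF po', symmetric] pullback_commute[OF pb] 1 2]
  have "is_pushout C q k' D' K (Id C K) x"
    using pushout_along_M_is_pullback[OF po' lM] pb by simp
  then show ?thesis using pushout_iso Id_iso[OF K] by blast
qed

text \<open>Both complements are compared with the pullback of \<open>f\<close> and
  \<open>f'\<close>, whose two projections are isomorphisms by symmetry; \<phi> is the inverse of
  one followed by the other.\<close>

lemma pushout_complement_unique:
  assumes po: "is_pushout C f m G K l k" and po': "is_pushout C f' m G K l k'" and lM: "l \<in> M"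
    and k: "k \<in> Hom C K D" and k': "k' \<in> Hom C K D'"
  obtains \<phi> where "\<phi> \<in> Hom C D D'" "is_iso C \<phi>" "\<phi> \<cdot> k = k'" "f' \<cdot> \<phi> = f"
proof -
  have f: "f \<in> Hom C D G" using pushout_Hom[OF po] k by blast
  have f': "f' \<in> Hom C D' G" using pushout_Hom[OF po'] k' by blast
  have "f \<in> M" using M_pushout_closed[OF po] lM by blast
  then obtain P p q where pb: "is_pullback C P p q f f' G"
    using M_pullback_ex[OF f f'] by blast
  have p: "p \<in> Hom C P D" and q: "q \<in> Hom C P D'" using pullback_Hom[OF pb] f f' by blast+
  have "f \<cdot> k = f' \<cdot> k'" using pushout_commute[OF po] pushout_commute[OF po'] by simp
  from pullback_ex1[OF pb f f' k k' this]
  obtain x where x: "x \<in> Hom C K P" "p \<cdot> x = k" "q \<cdot> x = k'" by blast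
  have q_iso: "is_iso C q"
    using pushout_complement_projection_iso[OF po po' lM pb x] .
  have "is_iso C p"
    using pushout_complement_projection_iso[OF po' po lM pullback_sym[OF pb] x(1,3,2)] .
  then obtain v where v: "v \<in> Hom C D P" "v \<cdot> p = Id C P" "p \<cdot> v = Id C D"
    using isoE[OF _ p] by blast
  have "is_iso C v" using isoI[OF v(1) p v(3,2)] .
  show ?thesis
  proof (rule that)
    show "q \<cdot> v \<in> Hom C D D'" using q v Comp_Hom by blast
    show "is_iso C (q \<cdot> v)" using iso_comp[OF v(1) \<open>is_iso C v\<close> q q_iso] .
    have "v \<cdot> k = x"
      using x(1) p v(1) Hom_Obj[OF p] by (simp add: x(2)[symmetric] cat_simps Comp_reduce[OF v(2)])
    then show "q \<cdot> v \<cdot> k = k'" using q v(1) k x(3) by (simp add: cat_simps)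
    show "f' \<cdot> (q \<cdot> v) = f"
      using q v(1) p f f' Hom_Obj[OF f] v(3)
      by (simp add: cat_simps Comp_reduce[OF pullback_commute[OF pb, symmetric]])
  qed
qed

section \<open>Weak double-pushouts\<close>

text \<open>Equal matches give isomorphic pushout complements of \<open>l_of \<rho>\<close>, and the
  right-hand pushouts carry this isomorphism over to the results.\<close>

lemma transformation_iso_iff:
  assumes \<rho>: "is_M_weak_span C M \<rho>"
    and \<gamma>: "\<gamma> \<in> weak_double_pushouts C G \<rho>" and \<delta>: "\<delta> \<in> weak_double_pushouts C G \<rho>"
  shows "transformation_iso C \<gamma> \<delta> \<longleftrightarrow> m_of \<gamma> = m_of \<delta>"
proof
  assume eq: "m_of \<gamma> = m_of \<delta>"
  have i: "i_of \<rho> \<in> Hom C (I_of \<rho>) (K_of \<rho>)" and r: "r_of \<rho> \<in> Hom C (I_of \<rho>) (R_of \<rho>)"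
    and lM: "l_of \<rho> \<in> M"
    using \<rho> unfolding is_M_weak_span_def is_weak_span_def by auto
  have h: "k_of \<gamma> \<in> Hom C (K_of \<rho>) (D_of \<gamma>)" "g_of \<gamma> \<in> Hom C (D_of \<gamma>) (H_of \<gamma>)"
    "n_of \<gamma> \<in> Hom C (R_of \<rho>) (H_of \<gamma>)"
    "is_pushout C (g_of \<gamma>) (n_of \<gamma>) (H_of \<gamma>) (I_of \<rho>) (r_of \<rho>) (k_of \<gamma> \<cdot> i_of \<rho>)"
    "is_pushout C (f_of \<gamma>) (m_of \<gamma>) G (K_of \<rho>) (l_of \<rho>) (k_of \<gamma>)"
    using \<gamma> unfolding weak_double_pushouts_def is_direct_transformation_def by auto
  have h': "k_of \<delta> \<in> Hom C (K_of \<rho>) (D_of \<delta>)" "g_of \<delta> \<in> Hom C (D_of \<delta>) (H_of \<delta>)"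
    "n_of \<delta> \<in> Hom C (R_of \<rho>) (H_of \<delta>)"
    "is_pushout C (g_of \<delta>) (n_of \<delta>) (H_of \<delta>) (I_of \<rho>) (r_of \<rho>) (k_of \<delta> \<cdot> i_of \<rho>)"
    "is_pushout C (f_of \<delta>) (m_of \<gamma>) G (K_of \<rho>) (l_of \<rho>) (k_of \<delta>)"
    using \<delta> eq unfolding weak_double_pushouts_def is_direct_transformation_def by auto
  obtain \<phi> where \<phi>: "\<phi> \<in> Hom C (D_of \<gamma>) (D_of \<delta>)" "is_iso C \<phi>" "\<phi> \<cdot> k_of \<gamma> = k_of \<delta>"
    "f_of \<delta> \<cdot> \<phi> = f_of \<gamma>"
    using pushout_complement_unique[OF h(5) h'(5) lM h(1) h'(1)] .
  have ki: "k_of \<gamma> \<cdot> i_of \<rho> \<in> Hom C (I_of \<rho>) (D_of \<gamma>)" using i h(1) Comp_Hom by blast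
  have \<phi>ki: "\<phi> \<cdot> (k_of \<gamma> \<cdot> i_of \<rho>) = k_of \<delta> \<cdot> i_of \<rho>"
    using i h(1) \<phi>(1) by (simp add: cat_simps Comp_reduce[OF \<phi>(3)])
  have "g_of \<delta> \<cdot> \<phi> \<cdot> (k_of \<gamma> \<cdot> i_of \<rho>) = n_of \<delta> \<cdot> r_of \<rho>"
    using Comp_assoc[OF ki \<phi>(1) h'(2)] \<phi>ki pushout_commute[OF h'(4)] by simp
  from pushout_ex[OF h(4) ki r Comp_Hom[OF \<phi>(1) h'(2)] h'(3) this]
  obtain \<psi> where \<psi>: "\<psi> \<in> Hom C (H_of \<gamma>) (H_of \<delta>)" "\<psi> \<cdot> g_of \<gamma> = g_of \<delta> \<cdot> \<phi>"
    "\<psi> \<cdot> n_of \<gamma> = n_of \<delta>" .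
  have "is_pushout C (g_of \<delta>) (\<psi> \<cdot> n_of \<gamma>) (H_of \<delta>) (I_of \<rho>) (r_of \<rho>) (\<phi> \<cdot> (k_of \<gamma> \<cdot> i_of \<rho>))"
    using h'(4) \<psi>(3) \<phi>ki by simp
  \<comment> \<open>Cancellation exhibits \<psi> as a pushout of the isomorphism \<phi> along
    \<open>g_of \<gamma>\<close>.\<close>
  from pushout_sym[OF pushout_cancel[OF h(4) this \<psi>(1) \<phi>(1) ki \<psi>(2)]]
  have "is_iso C \<psi>" using pushout_iso \<phi>(2) by blast
  with \<phi> \<psi> eq show "transformation_iso C \<gamma> \<delta>"
    unfolding transformation_iso_def by (intro exI[of _ \<phi>] exI[of _ \<psi>]) auto
qed (auto simp: transformation_iso_def)

section \<open>Parallel transformations of a pair in terms of squares\<close>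

lemma pair_transformationE:
  assumes "pair_transformation C G \<rho>1 \<gamma>1 \<rho>2 \<gamma>2 H"
  obtains j1 j2 P e1 e2 d1 d2 s1 s2 t1 t2 F1 F2 h1 h2 where
    "parallel_independent_via C \<rho>1 \<gamma>1 \<rho>2 \<gamma>2 j1 j2"
    "is_pullback C P e1 e2 (f_of \<gamma>1) (f_of \<gamma>2) G"
    "d1 \<in> Hom C (I_of \<rho>1) P" "e1 \<cdot> d1 = k_of \<gamma>1 \<cdot> i_of \<rho>1"
    "d2 \<in> Hom C (I_of \<rho>2) P" "e2 \<cdot> d2 = k_of \<gamma>2 \<cdot> i_of \<rho>2"
    "is_pushout C s1 t1 F1 (I_of \<rho>1) (r_of \<rho>1) d1"
    "is_pushout C s2 t2 F2 (I_of \<rho>2) (r_of \<rho>2) d2"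
    "is_pushout C h1 h2 H P s2 s1"
proof -
  obtain j1 j2 where j: "parallel_independent_via C \<rho>1 \<gamma>1 \<rho>2 \<gamma>2 j1 j2"
    and pct: "parallel_coherent_transformation C G (pair_diagram C \<rho>1 \<gamma>1 \<rho>2 \<gamma>2 j1 j2) H"
    using assms unfolding pair_transformation_def by blast
  let ?\<Gamma> = "pair_diagram C \<rho>1 \<gamma>1 \<rho>2 \<gamma>2 j1 j2"
  have sz: "size_of ?\<Gamma> = 2" "{1..2} = {1, 2::nat}" by (auto simp: pair_diagram_def)
  obtain P e d s t F h where
    lim: "is_limit C 2 P e (\<lambda>a. f_of (trans_of ?\<Gamma> a)) G" and
    d: "\<forall>c\<in>{1, 2}. d c \<in> Hom C (I_of (span_of ?\<Gamma> c)) P \<and> (\<forall>a\<in>{1, 2}. j_of ?\<Gamma> c a = e a \<cdot> d c)" and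
    po: "\<forall>a\<in>{1, 2}. is_pushout C (s a) (t a) (F a) (I_of (span_of ?\<Gamma> a)) (r_of (span_of ?\<Gamma> a)) (d a)" and
    colim: "is_colimit C 2 h H P s"
    using pct unfolding parallel_coherent_transformation_def sz by (elim conjE exE)
  show ?thesis
  proof (rule that[OF j])
    show "is_pullback C P (e 1) (e 2) (f_of \<gamma>1) (f_of \<gamma>2) G"
      using lim[folded pullback_iff_limit] by (simp add: pair_diagram_def)
    show "is_pushout C (h 1) (h 2) H P (s 2) (s 1)"
      using colim[folded pushout_iff_colimit] .
    show "d 1 \<in> Hom C (I_of \<rho>1) P" "e 1 \<cdot> d 1 = k_of \<gamma>1 \<cdot> i_of \<rho>1"
      "d 2 \<in> Hom C (I_of \<rho>2) P" "e 2 \<cdot> d 2 = k_of \<gamma>2 \<cdot> i_of \<rho>2"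
      using d by (auto simp: pair_diagram_def)
    show "is_pushout C (s 1) (t 1) (F 1) (I_of \<rho>1) (r_of \<rho>1) (d 1)"
      "is_pushout C (s 2) (t 2) (F 2) (I_of \<rho>2) (r_of \<rho>2) (d 2)"
      using po by (auto simp: pair_diagram_def)
  qed
qed

lemma pair_transformationI:
  assumes \<rho>: "is_weak_span C \<rho>1" "is_weak_span C \<rho>2"
    and \<gamma>: "is_direct_transformation C G \<rho>1 \<gamma>1" "is_direct_transformation C G \<rho>2 \<gamma>2"
    and j: "parallel_independent_via C \<rho>1 \<gamma>1 \<rho>2 \<gamma>2 j1 j2"
    and pb: "is_pullback C P e1 e2 (f_of \<gamma>1) (f_of \<gamma>2) G"
    and d1: "d1 \<in> Hom C (I_of \<rho>1) P" "e1 \<cdot> d1 = k_of \<gamma>1 \<cdot> i_of \<rho>1" "e2 \<cdot> d1 = j1 \<cdot> (l_of \<rho>1 \<cdot> i_of \<rho>1)"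
    and d2: "d2 \<in> Hom C (I_of \<rho>2) P" "e2 \<cdot> d2 = k_of \<gamma>2 \<cdot> i_of \<rho>2" "e1 \<cdot> d2 = j2 \<cdot> (l_of \<rho>2 \<cdot> i_of \<rho>2)"
    and po: "is_pushout C s1 t1 F1 (I_of \<rho>1) (r_of \<rho>1) d1" "is_pushout C s2 t2 F2 (I_of \<rho>2) (r_of \<rho>2) d2"
    and po': "is_pushout C h1 h2 H P s2 s1"
  shows "pair_transformation C G \<rho>1 \<gamma>1 \<rho>2 \<gamma>2 H"
proof -
  let ?\<Gamma> = "pair_diagram C \<rho>1 \<gamma>1 \<rho>2 \<gamma>2 j1 j2"
  have sz: "size_of ?\<Gamma> = 2" "{1..2} = {1, 2::nat}" by (auto simp: pair_diagram_def)
  have f: "f_of \<gamma>1 \<in> Hom C (D_of \<gamma>1) G" "f_of \<gamma>2 \<in> Hom C (D_of \<gamma>2) G"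
    using \<gamma> by (auto simp: is_direct_transformation_def)
  have e: "e1 \<in> Hom C P (D_of \<gamma>1)" "e2 \<in> Hom C P (D_of \<gamma>2)"
    using pullback_Hom[OF pb] f by blast+
  have ed: "e1 \<cdot> d1 \<in> Hom C (I_of \<rho>1) (D_of \<gamma>1)" "e2 \<cdot> d1 \<in> Hom C (I_of \<rho>1) (D_of \<gamma>2)"
    "e1 \<cdot> d2 \<in> Hom C (I_of \<rho>2) (D_of \<gamma>1)" "e2 \<cdot> d2 \<in> Hom C (I_of \<rho>2) (D_of \<gamma>2)"
    using e d1 d2 Comp_Hom by blast+
  have fe: "f_of \<gamma>2 \<cdot> (e2 \<cdot> d1) = f_of \<gamma>1 \<cdot> (e1 \<cdot> d1)" "f_of \<gamma>1 \<cdot> (e1 \<cdot> d2) = f_of \<gamma>2 \<cdot> (e2 \<cdot> d2)"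
    using e d1(1) d2(1) f by (simp_all add: cat_simps Comp_reduce[OF pullback_commute[OF pb]])
  have coh: "is_parallel_coherent C G ?\<Gamma>"
    unfolding is_parallel_coherent_def sz
    using \<rho> \<gamma> ed[unfolded d1 d2] fe[unfolded d1 d2] by (simp add: pair_diagram_def)
  \<comment> \<open>As in \<open>pair_diagram\<close>, every index other than 1 gets the data of the
    second transformation.\<close>
  define e where "e = (\<lambda>a::nat. if a = 1 then e1 else e2)"
  define d where "d = (\<lambda>a::nat. if a = 1 then d1 else d2)"
  define s where "s = (\<lambda>a::nat. if a = 1 then s1 else s2)"
  define t where "t = (\<lambda>a::nat. if a = 1 then t1 else t2)"
  define F where "F = (\<lambda>a::nat. if a = 1 then F1 else F2)"
  define h where "h = (\<lambda>a::nat. if a = 1 then h1 else h2)"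
  have "is_limit C 2 P e (\<lambda>a. f_of (trans_of ?\<Gamma> a)) G"
    unfolding pullback_iff_limit[symmetric] using pb by (simp add: e_def pair_diagram_def)
  moreover have "\<forall>c\<in>{1, 2}. d c \<in> Hom C (I_of (span_of ?\<Gamma> c)) P \<and>
      (\<forall>a\<in>{1, 2}. j_of ?\<Gamma> c a = e a \<cdot> d c)"
    using d1 d2 by (simp add: e_def d_def pair_diagram_def)
  moreover have "\<forall>a\<in>{1, 2}.
      is_pushout C (s a) (t a) (F a) (I_of (span_of ?\<Gamma> a)) (r_of (span_of ?\<Gamma> a)) (d a)"
    using po by (simp add: s_def t_def F_def d_def pair_diagram_def)
  moreover have "is_colimit C 2 h H P s"
    unfolding pushout_iff_colimit[symmetric] using po' by (simp add: h_def s_def)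
  ultimately have "parallel_coherent_transformation C G ?\<Gamma> H"
    unfolding parallel_coherent_transformation_def sz
    by (intro conjI[OF coh]) (rule exI[of _ P], rule exI[of _ e], rule exI[of _ d], rule exI[of _ s],
      rule exI[of _ t], rule exI[of _ F], rule exI[of _ h], intro conjI)
  with j show ?thesis unfolding pair_transformation_def by blast
qed

section \<open>Legs and matches of weak double-pushouts\<close>

lemma weak_double_pushoutD:
  assumes "\<gamma> \<in> weak_double_pushouts C G \<rho>"
  shows "is_direct_transformation C G \<rho> \<gamma>"
    and "m_of \<gamma> \<in> Hom C (L_of \<rho>) G" "k_of \<gamma> \<in> Hom C (K_of \<rho>) (D_of \<gamma>)"
    "f_of \<gamma> \<in> Hom C (D_of \<gamma>) G" "g_of \<gamma> \<in> Hom C (D_of \<gamma>) (H_of \<gamma>)"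
    "n_of \<gamma> \<in> Hom C (R_of \<rho>) (H_of \<gamma>)"
    "is_pushout C (g_of \<gamma>) (n_of \<gamma>) (H_of \<gamma>) (I_of \<rho>) (r_of \<rho>) (k_of \<gamma> \<cdot> i_of \<rho>)"
    "is_pushout C (f_of \<gamma>) (m_of \<gamma>) G (K_of \<rho>) (l_of \<rho>) (k_of \<gamma>)"
  using assms unfolding weak_double_pushouts_def is_direct_transformation_def by auto

lemma M_weak_spanD:
  assumes "is_M_weak_span C M \<rho>"
  shows "is_weak_span C \<rho>" "l_of \<rho> \<in> Hom C (K_of \<rho>) (L_of \<rho>)" "i_of \<rho> \<in> Hom C (I_of \<rho>) (K_of \<rho>)"
    "r_of \<rho> \<in> Hom C (I_of \<rho>) (R_of \<rho>)" "l_of \<rho> \<in> M" "i_of \<rho> \<in> M" "r_of \<rho> \<in> M"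
  using assms unfolding is_M_weak_span_def is_weak_span_def by auto

lemma weak_double_pushout_M:
  assumes "is_M_weak_span C M \<rho>" "\<gamma> \<in> weak_double_pushouts C G \<rho>"
  shows "f_of \<gamma> \<in> M" "g_of \<gamma> \<in> M"
  using M_weak_spanD[OF assms(1)] weak_double_pushoutD(7,8)[OF assms(2)] M_pushout_closed by blast+

text \<open>\<open>\<gamma>\<close> and \<open>\<gamma>'\<close> have the same match up to transport along \<open>G \<leftarrow> D\<^sub>1 \<rightarrow> H\<^sub>1\<close>. As weak
  double-pushouts are determined by their matches and both legs are monic, this relation alone
  pins down the two correspondences.\<close>

definition residual ::
  "('o, 'm) transformation \<Rightarrow> ('o, 'm) weak_span \<Rightarrow> ('o, 'm) transformation \<Rightarrow> ('o, 'm) transformation \<Rightarrow> bool"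
  where "residual \<gamma>1 \<rho> \<gamma> \<gamma>' \<longleftrightarrow>
    (\<exists>j \<in> Hom C (L_of \<rho>) (D_of \<gamma>1). m_of \<gamma> = f_of \<gamma>1 \<cdot> j \<and> m_of \<gamma>' = g_of \<gamma>1 \<cdot> j)"

text \<open>The legs \<open>f_of \<gamma>1\<close> and \<open>g_of \<gamma>1\<close> lie in
  \<open>M\<close>, so either equality of matches amounts to equality of the two factorisations
  through \<open>D_of \<gamma>1\<close>.\<close>

lemma residual_match_eq_iff:
  assumes \<rho>: "is_M_weak_span C M \<rho>1" and \<gamma>1: "\<gamma>1 \<in> weak_double_pushouts C G \<rho>1"
    and "residual \<gamma>1 \<rho> \<gamma> \<gamma>'" "residual \<gamma>1 \<rho> \<delta> \<delta>'"
  shows "m_of \<gamma> = m_of \<delta> \<longleftrightarrow> m_of \<gamma>' = m_of \<delta>'"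
proof -
  obtain j where j: "j \<in> Hom C (L_of \<rho>) (D_of \<gamma>1)" "m_of \<gamma> = f_of \<gamma>1 \<cdot> j" "m_of \<gamma>' = g_of \<gamma>1 \<cdot> j"
    using assms(3) unfolding residual_def by blast
  obtain j' where j': "j' \<in> Hom C (L_of \<rho>) (D_of \<gamma>1)" "m_of \<delta> = f_of \<gamma>1 \<cdot> j'" "m_of \<delta>' = g_of \<gamma>1 \<cdot> j'"
    using assms(4) unfolding residual_def by blast
  note mono = M_mono[OF weak_double_pushout_M(1)[OF \<rho> \<gamma>1]] M_mono[OF weak_double_pushout_M(2)[OF \<rho> \<gamma>1]]
  have "f_of \<gamma>1 \<cdot> j = f_of \<gamma>1 \<cdot> j' \<longleftrightarrow> j = j'"
    using monoD[OF mono(1) weak_double_pushoutD(4)[OF \<gamma>1] j(1) j'(1)] by blast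
  moreover have "g_of \<gamma>1 \<cdot> j = g_of \<gamma>1 \<cdot> j' \<longleftrightarrow> j = j'"
    using monoD[OF mono(2) weak_double_pushoutD(5)[OF \<gamma>1] j(1) j'(1)] by blast
  ultimately show ?thesis using j j' by simp
qed

text \<open>The intermediate object \<open>F1\<close> of the parallel transformation serves as the
  context of the second step, and the colimit square at \<open>H\<close> provides its right-hand
  side.\<close>

lemma analysis:
  assumes \<rho>1: "is_M_weak_span C M \<rho>1" and \<rho>2: "is_M_weak_span C M \<rho>2"
    and \<gamma>1: "\<gamma>1 \<in> weak_double_pushouts C G \<rho>1" and \<gamma>2: "\<gamma>2 \<in> weak_double_pushouts C G \<rho>2"
    and pair: "pair_transformation C G \<rho>1 \<gamma>1 \<rho>2 \<gamma>2 H"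
  obtains \<gamma>2' where "\<gamma>2' \<in> weak_double_pushouts C (H_of \<gamma>1) \<rho>2" "H_of \<gamma>2' = H"
    "sequential_independent C \<rho>1 \<gamma>1 \<rho>2 \<gamma>2'" "residual \<gamma>1 \<rho>2 \<gamma>2 \<gamma>2'"
proof -
  note S1 = M_weak_spanD[OF \<rho>1] and S2 = M_weak_spanD[OF \<rho>2]
  note T1 = weak_double_pushoutD[OF \<gamma>1] and T2 = weak_double_pushoutD[OF \<gamma>2]
  note f1M = weak_double_pushout_M(1)[OF \<rho>1 \<gamma>1] and f2M = weak_double_pushout_M(1)[OF \<rho>2 \<gamma>2]
  obtain j1 j2 P e1 e2 d1 d2 s1 s2 t1 t2 F1 F2 h1 h2 where
    j: "parallel_independent_via C \<rho>1 \<gamma>1 \<rho>2 \<gamma>2 j1 j2" and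
    pb: "is_pullback C P e1 e2 (f_of \<gamma>1) (f_of \<gamma>2) G" and
    d1: "d1 \<in> Hom C (I_of \<rho>1) P" "e1 \<cdot> d1 = k_of \<gamma>1 \<cdot> i_of \<rho>1" and
    d2: "d2 \<in> Hom C (I_of \<rho>2) P" "e2 \<cdot> d2 = k_of \<gamma>2 \<cdot> i_of \<rho>2" and
    po_s1: "is_pushout C s1 t1 F1 (I_of \<rho>1) (r_of \<rho>1) d1" and
    po_s2: "is_pushout C s2 t2 F2 (I_of \<rho>2) (r_of \<rho>2) d2" and
    po_h: "is_pushout C h1 h2 H P s2 s1"
    using pair by (rule pair_transformationE)
  have j1: "j1 \<in> Hom C (L_of \<rho>1) (D_of \<gamma>2)" "f_of \<gamma>2 \<cdot> j1 = m_of \<gamma>1"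
    and j2: "j2 \<in> Hom C (L_of \<rho>2) (D_of \<gamma>1)" "f_of \<gamma>1 \<cdot> j2 = m_of \<gamma>2"
    using j unfolding parallel_independent_via_def by auto
  have e1: "e1 \<in> Hom C P (D_of \<gamma>1)" and e2: "e2 \<in> Hom C P (D_of \<gamma>2)"
    using pullback_Hom[OF pb] T1(4) T2(4) by blast+
  have e1M: "e1 \<in> M" and e2M: "e2 \<in> M" using M_pullback_closed[OF pb] f1M f2M by blast+
  \<comment> \<open>Each left-hand pushout is pulled back along the other context morphism, which
    lifts \<open>k_of \<gamma>1\<close> and \<open>k_of \<gamma>2\<close> to \<open>P\<close>. The
    second one also presents \<open>D_of \<gamma>1\<close> as \<open>P\<close> with
    \<open>L_of \<rho>2\<close> glued on.\<close>
  obtain a1 where a1: "a1 \<in> Hom C (K_of \<rho>1) P" "e1 \<cdot> a1 = k_of \<gamma>1" "e2 \<cdot> a1 = j1 \<cdot> l_of \<rho>1"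
    using pushout_pullback_decomposition[OF T1(8) S1(5) pb f2M S1(2) T1(3) T2(4) j1] .
  obtain a2 where a2: "a2 \<in> Hom C (K_of \<rho>2) P" "e2 \<cdot> a2 = k_of \<gamma>2"
    "is_pushout C e1 j2 (D_of \<gamma>1) (K_of \<rho>2) (l_of \<rho>2) a2"
    using pushout_pullback_decomposition[OF T2(8) S2(5) pullback_sym[OF pb] f1M S2(2) T2(3) T1(4) j2] .
  have d1_eq: "d1 = a1 \<cdot> i_of \<rho>1"
  proof (rule monoD[OF M_mono[OF e1M] e1 d1(1) Comp_Hom[OF S1(3) a1(1)]])
    show "e1 \<cdot> d1 = e1 \<cdot> (a1 \<cdot> i_of \<rho>1)"
      using Comp_assoc[OF S1(3) a1(1) e1] a1(2) d1(2) by simp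
  qed
  have d2_eq: "d2 = a2 \<cdot> i_of \<rho>2"
  proof (rule monoD[OF M_mono[OF e2M] e2 d2(1) Comp_Hom[OF S2(3) a2(1)]])
    show "e2 \<cdot> d2 = e2 \<cdot> (a2 \<cdot> i_of \<rho>2)"
      using Comp_assoc[OF S2(3) a2(1) e2] a2(2) d2(2) by simp
  qed
  have s1: "s1 \<in> Hom C P F1" and t1: "t1 \<in> Hom C (R_of \<rho>1) F1"
    using pushout_Hom[OF po_s1] d1(1) S1(4) by blast+
  have s2: "s2 \<in> Hom C P F2" and t2: "t2 \<in> Hom C (R_of \<rho>2) F2"
    using pushout_Hom[OF po_s2] d2(1) S2(4) by blast+
  have h1: "h1 \<in> Hom C F1 H" and h2: "h2 \<in> Hom C F2 H"
    using pushout_Hom[OF po_h] s1 s2 by blast+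
  have "g_of \<gamma>1 \<cdot> e1 \<cdot> d1 = n_of \<gamma>1 \<cdot> r_of \<rho>1"
    using Comp_assoc[OF d1(1) e1 T1(5)] d1(2) pushout_commute[OF T1(7)] by simp
  from pushout_ex[OF po_s1 d1(1) S1(4) Comp_Hom[OF e1 T1(5)] T1(6) this]
  obtain f' where f': "f' \<in> Hom C F1 (H_of \<gamma>1)" "f' \<cdot> s1 = g_of \<gamma>1 \<cdot> e1" "f' \<cdot> t1 = n_of \<gamma>1" .
  \<comment> \<open>The right-hand pushout of \<gamma>1 factors through \<open>F1\<close>, so
    \<open>H_of \<gamma>1\<close> is the pushout of \<open>s1\<close> and \<open>e1\<close> over
    \<open>P\<close>.\<close>
  have "is_pushout C (g_of \<gamma>1) (f' \<cdot> t1) (H_of \<gamma>1) (I_of \<rho>1) (r_of \<rho>1) (e1 \<cdot> d1)"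
    using T1(7) f'(3) d1(2) by simp
  note po_f' = pushout_cancel[OF po_s1 this f'(1) e1 d1(1) f'(2)]
  let ?k = "s1 \<cdot> a2" and ?m = "g_of \<gamma>1 \<cdot> j2" and ?n = "h2 \<cdot> t2"
  have k: "?k \<in> Hom C (K_of \<rho>2) F1" and m: "?m \<in> Hom C (L_of \<rho>2) (H_of \<gamma>1)"
    and n: "?n \<in> Hom C (R_of \<rho>2) H"
    using s1 a2(1) T1(5) j2(1) h2 t2 Comp_Hom by blast+
  \<comment> \<open>The left square of the new transformation stacks the gluing of
    \<open>L_of \<rho>2\<close> to \<open>P\<close> on the square of \<open>P\<close>,
    \<open>D_of \<gamma>1\<close>, \<open>F1\<close> and \<open>H_of \<gamma>1\<close>.\<close>
  have po_m: "is_pushout C f' ?m (H_of \<gamma>1) (K_of \<rho>2) (l_of \<rho>2) ?k"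
    using pushout_paste[OF a2(3) pushout_sym[OF po_f']] .
  \<comment> \<open>The right square stacks the pushout defining \<open>F2\<close> on the colimit
    square over \<open>P\<close>.\<close>
  have po_n: "is_pushout C h1 ?n H (I_of \<rho>2) (r_of \<rho>2) (?k \<cdot> i_of \<rho>2)"
    using pushout_paste[OF po_s2 po_h] Comp_assoc[OF S2(3) a2(1) s1] d2_eq by simp
  let ?\<gamma> = "\<lparr>D_of = F1, H_of = H, m_of = ?m, k_of = ?k, f_of = f', g_of = h1, n_of = ?n\<rparr>"
  have wdp: "?\<gamma> \<in> weak_double_pushouts C (H_of \<gamma>1) \<rho>2"
    unfolding weak_double_pushouts_def is_direct_transformation_def
    using k m n f'(1) h1 po_m po_n pushout_commute[OF po_m] Hom_Obj[OF h1] by simp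
  obtain i' r' R' where assoc: "is_pushout C i' r' R' (I_of \<rho>1) (i_of \<rho>1) (r_of \<rho>1)"
    using M_pushout_ex[OF S1(3,4)] S1(6) by blast
  have i': "i' \<in> Hom C (R_of \<rho>1) R'" and r': "r' \<in> Hom C (K_of \<rho>1) R'"
    using pushout_Hom[OF assoc] S1(3,4) by blast+
  have "n_of \<gamma>1 \<cdot> r_of \<rho>1 = g_of \<gamma>1 \<cdot> k_of \<gamma>1 \<cdot> i_of \<rho>1"
    using Comp_assoc[OF S1(3) T1(3,5)] pushout_commute[OF T1(7)] by simp
  from pushout_ex[OF assoc S1(4,3) T1(6) Comp_Hom[OF T1(3,5)] this]
  obtain n' where n': "n' \<in> Hom C R' (H_of \<gamma>1)" "n' \<cdot> i' = n_of \<gamma>1" "n' \<cdot> r' = g_of \<gamma>1 \<cdot> k_of \<gamma>1" .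
  \<comment> \<open>The morphism from \<open>R'\<close> to \<open>F1\<close> required by sequential
    independence is induced by \<open>t1\<close> and \<open>s1 \<cdot> a1\<close>, which agree on
    \<open>I_of \<rho>1\<close>.\<close>
  have "t1 \<cdot> r_of \<rho>1 = s1 \<cdot> a1 \<cdot> i_of \<rho>1"
    using Comp_assoc[OF S1(3) a1(1) s1] d1_eq pushout_commute[OF po_s1] by simp
  from pushout_ex[OF assoc S1(4,3) t1 Comp_Hom[OF a1(1) s1] this]
  obtain j' where j': "j' \<in> Hom C R' F1" "j' \<cdot> i' = t1" "j' \<cdot> r' = s1 \<cdot> a1" .
  have "f' \<cdot> j' = n'"
  proof (rule pushout_eq[OF assoc Comp_Hom[OF j'(1) f'(1)] n'(1)])
    show "f' \<cdot> j' \<cdot> i' = n' \<cdot> i'"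
      using Comp_assoc[OF i' j'(1) f'(1)] j'(2) f'(3) n'(2) by simp
    have "f' \<cdot> j' \<cdot> r' = g_of \<gamma>1 \<cdot> (e1 \<cdot> a1)"
      using r' j'(1) f'(1) s1 a1(1) T1(5) e1
      by (simp add: cat_simps j'(3) Comp_reduce[OF f'(2)])
    then show "f' \<cdot> j' \<cdot> r' = n' \<cdot> r'" using a1(2) n'(3) by simp
  qed
  with assoc n' j' j2(1) have seq: "sequential_independent C \<rho>1 \<gamma>1 \<rho>2 ?\<gamma>"
    unfolding sequential_independent_def is_associated_span_def
    by (intro exI[of _ i'] exI[of _ r'] exI[of _ R'] exI[of _ n'] exI[of _ j'] exI[of _ j2]) simp
  have "residual \<gamma>1 \<rho>2 \<gamma>2 ?\<gamma>" unfolding residual_def using j2 by (intro bexI[of _ j2]) auto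
  with wdp seq show ?thesis using that by simp
qed

text \<open>The context of \<gamma>2' turns out to be \<open>P\<close> with \<open>R'\<close> glued
  along \<open>K_of \<rho>1\<close>. Gluing \<open>L_of \<rho>1\<close> along the same
  \<open>d1\<close> instead undoes the first step and yields the context over
  \<open>G\<close>.\<close>

lemma synthesis:
  assumes \<rho>1: "is_M_weak_span C M \<rho>1" and \<rho>2: "is_M_weak_span C M \<rho>2"
    and \<gamma>1: "\<gamma>1 \<in> weak_double_pushouts C G \<rho>1"
    and \<gamma>2': "\<gamma>2' \<in> weak_double_pushouts C (H_of \<gamma>1) \<rho>2"
    and seq: "sequential_independent C \<rho>1 \<gamma>1 \<rho>2 \<gamma>2'"
  obtains \<gamma>2 where "\<gamma>2 \<in> weak_double_pushouts C G \<rho>2" "parallel_independent C \<rho>1 \<gamma>1 \<rho>2 \<gamma>2"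
    "pair_transformation C G \<rho>1 \<gamma>1 \<rho>2 \<gamma>2 (H_of \<gamma>2')" "residual \<gamma>1 \<rho>2 \<gamma>2 \<gamma>2'"
proof -
  note S1 = M_weak_spanD[OF \<rho>1] and S2 = M_weak_spanD[OF \<rho>2]
  note T1 = weak_double_pushoutD[OF \<gamma>1] and T2 = weak_double_pushoutD[OF \<gamma>2']
  note g1M = weak_double_pushout_M(2)[OF \<rho>1 \<gamma>1] and f2M = weak_double_pushout_M(1)[OF \<rho>2 \<gamma>2']
  obtain i' r' R' n' j' j2 where assoc: "is_pushout C i' r' R' (I_of \<rho>1) (i_of \<rho>1) (r_of \<rho>1)"
    and n': "n' \<in> Hom C R' (H_of \<gamma>1)" "n' \<cdot> i' = n_of \<gamma>1" "n' \<cdot> r' = g_of \<gamma>1 \<cdot> k_of \<gamma>1"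
    and j': "j' \<in> Hom C R' (D_of \<gamma>2')" "f_of \<gamma>2' \<cdot> j' = n'"
    and j2: "j2 \<in> Hom C (L_of \<rho>2) (D_of \<gamma>1)" "g_of \<gamma>1 \<cdot> j2 = m_of \<gamma>2'"
    using seq unfolding sequential_independent_def is_associated_span_def by blast
  have r': "r' \<in> Hom C (K_of \<rho>1) R'" using pushout_Hom[OF assoc] S1(3) by blast
  have r'M: "r' \<in> M" using M_pushout_closed[OF assoc] S1(7) by blast
  \<comment> \<open>Cancelling the pushout of the associated span leaves
    \<open>H_of \<gamma>1\<close> as a pushout of \<open>r'\<close> and
    \<open>k_of \<gamma>1\<close>. As \<open>r'\<close> is in \<open>M\<close>, this square can be
    decomposed like a left-hand one.\<close>
  have "is_pushout C (g_of \<gamma>1) (n' \<cdot> i') (H_of \<gamma>1) (I_of \<rho>1) (r_of \<rho>1) (k_of \<gamma>1 \<cdot> i_of \<rho>1)"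
    using T1(7) n'(2) by simp
  note po_n' = pushout_cancel[OF pushout_sym[OF assoc] this n'(1) T1(3) S1(3) n'(3)]
  obtain P e1 s where pb: "is_pullback C P e1 s (g_of \<gamma>1) (f_of \<gamma>2') (H_of \<gamma>1)"
    using M_pullback_ex[OF T1(5) T2(4)] g1M by blast
  have e1: "e1 \<in> Hom C P (D_of \<gamma>1)" and s: "s \<in> Hom C P (D_of \<gamma>2')"
    using pullback_Hom[OF pb] T1(5) T2(4) by blast+
  obtain d1 where d1: "d1 \<in> Hom C (K_of \<rho>1) P" "e1 \<cdot> d1 = k_of \<gamma>1"
    "is_pushout C s j' (D_of \<gamma>2') (K_of \<rho>1) r' d1"
    using pushout_pullback_decomposition[OF po_n' r'M pb f2M r' T1(3) T2(4) j'] .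
  obtain d2 where d2: "d2 \<in> Hom C (K_of \<rho>2) P" "s \<cdot> d2 = k_of \<gamma>2'" "e1 \<cdot> d2 = j2 \<cdot> l_of \<rho>2"
    "is_pushout C e1 j2 (D_of \<gamma>1) (K_of \<rho>2) (l_of \<rho>2) d2"
    using pushout_pullback_decomposition[OF T2(8) S2(5) pullback_sym[OF pb] g1M S2(2) T2(3) T1(5) j2] .
  \<comment> \<open>The new context is \<open>D2\<close>; its leg \<open>j1\<close> is one of the
    two morphisms needed for parallel independence.\<close>
  obtain e2 j1 D2 where po_D2: "is_pushout C e2 j1 D2 (K_of \<rho>1) (l_of \<rho>1) d1"
    using M_pushout_ex[OF S1(2) d1(1)] S1(5) by blast
  have e2: "e2 \<in> Hom C P D2" and j1: "j1 \<in> Hom C (L_of \<rho>1) D2"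
    using pushout_Hom[OF po_D2] d1(1) S1(2) by blast+
  have e2M: "e2 \<in> M" using M_pushout_closed[OF po_D2] S1(5) by blast
  have "f_of \<gamma>1 \<cdot> e1 \<cdot> d1 = m_of \<gamma>1 \<cdot> l_of \<rho>1"
    using Comp_assoc[OF d1(1) e1 T1(4)] d1(2) pushout_commute[OF T1(8)] by simp
  from pushout_ex[OF po_D2 d1(1) S1(2) Comp_Hom[OF e1 T1(4)] T1(2) this]
  obtain f2 where f2: "f2 \<in> Hom C D2 G" "f2 \<cdot> e2 = f_of \<gamma>1 \<cdot> e1" "f2 \<cdot> j1 = m_of \<gamma>1" .
  have "is_pushout C (f_of \<gamma>1) (f2 \<cdot> j1) G (K_of \<rho>1) (l_of \<rho>1) (e1 \<cdot> d1)"
    using T1(8) f2(3) d1(2) by simp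
  note po_f2 = pushout_cancel[OF po_D2 this f2(1) e1 d1(1) f2(2)]
  \<comment> \<open>\<open>P\<close> was formed as a pullback over \<open>H_of \<gamma>1\<close>.
    Since \<open>e2\<close> is in \<open>M\<close>, the pushout at \<open>G\<close> is a pullback as
    well, so \<open>P\<close> is also the limit that the parallel transformation asks for.\<close>
  note pb_G = pullback_sym[OF pushout_along_M_is_pullback[OF po_f2 e2M]]
  let ?k = "e2 \<cdot> d2" and ?m = "f_of \<gamma>1 \<cdot> j2"
  have k: "?k \<in> Hom C (K_of \<rho>2) D2" and m: "?m \<in> Hom C (L_of \<rho>2) G"
    using e2 d2(1) T1(4) j2(1) Comp_Hom by blast+
  have po_m: "is_pushout C f2 ?m G (K_of \<rho>2) (l_of \<rho>2) ?k"
    using pushout_paste[OF d2(4) pushout_sym[OF po_f2]] .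
  \<comment> \<open>\<open>H2\<close> is the result of applying \<rho>2 to \<open>G\<close> alone;
    it is distinct data from \<open>H_of \<gamma>2'\<close>, the result of the parallel
    transformation.\<close>
  obtain g2 n2 H2 where po_n: "is_pushout C g2 n2 H2 (I_of \<rho>2) (r_of \<rho>2) (?k \<cdot> i_of \<rho>2)"
    using M_pushout_ex[OF S2(4) Comp_Hom[OF S2(3) k]] S2(7) by blast
  have g2: "g2 \<in> Hom C D2 H2" and n2: "n2 \<in> Hom C (R_of \<rho>2) H2"
    using pushout_Hom[OF po_n] Comp_Hom[OF S2(3) k] S2(4) by blast+
  let ?\<gamma> = "\<lparr>D_of = D2, H_of = H2, m_of = ?m, k_of = ?k, f_of = f2, g_of = g2, n_of = n2\<rparr>"
  have wdp: "?\<gamma> \<in> weak_double_pushouts C G \<rho>2"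
    unfolding weak_double_pushouts_def is_direct_transformation_def
    using k m n2 f2(1) g2 po_m po_n pushout_commute[OF po_m] Hom_Obj[OF g2] by simp
  have via: "parallel_independent_via C \<rho>1 \<gamma>1 \<rho>2 ?\<gamma> j1 j2"
    unfolding parallel_independent_via_def using j1 j2(1) f2(3) by simp
  let ?d1 = "d1 \<cdot> i_of \<rho>1" and ?d2 = "d2 \<cdot> i_of \<rho>2"
  have d1': "?d1 \<in> Hom C (I_of \<rho>1) P" and d2': "?d2 \<in> Hom C (I_of \<rho>2) P"
    using d1(1) d2(1) S1(3) S2(3) Comp_Hom by blast+
  \<comment> \<open>\<open>D_of \<gamma>2'\<close> takes the role of the first intermediate object:
    its pushout over \<open>K_of \<rho>1\<close> is pasted with that of the associated span.\<close>
  have po_F1: "is_pushout C s (j' \<cdot> i') (D_of \<gamma>2') (I_of \<rho>1) (r_of \<rho>1) ?d1"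
    using pushout_paste[OF pushout_sym[OF assoc] d1(3)] .
  obtain s2 t2 F2 where po_F2: "is_pushout C s2 t2 F2 (I_of \<rho>2) (r_of \<rho>2) ?d2"
    using M_pushout_ex[OF S2(4) d2'] S2(7) by blast
  have sd2: "s \<cdot> ?d2 = k_of \<gamma>2' \<cdot> i_of \<rho>2"
    using Comp_assoc[OF S2(3) d2(1) s] d2(2) by simp
  have "g_of \<gamma>2' \<cdot> s \<cdot> ?d2 = n_of \<gamma>2' \<cdot> r_of \<rho>2"
    using Comp_assoc[OF d2' s T2(5)] sd2 pushout_commute[OF T2(7)] by simp
  from pushout_ex[OF po_F2 d2' S2(4) Comp_Hom[OF s T2(5)] T2(6) this]
  obtain h2 where h2: "h2 \<in> Hom C F2 (H_of \<gamma>2')" "h2 \<cdot> s2 = g_of \<gamma>2' \<cdot> s" "h2 \<cdot> t2 = n_of \<gamma>2'" .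
  \<comment> \<open>Splitting the right-hand pushout of \<gamma>2' at \<open>F2\<close> shows
    \<open>H_of \<gamma>2'\<close> to be the colimit of the two intermediate objects under
    \<open>P\<close>.\<close>
  have "is_pushout C (g_of \<gamma>2') (h2 \<cdot> t2) (H_of \<gamma>2') (I_of \<rho>2) (r_of \<rho>2) (s \<cdot> ?d2)"
    using T2(7) h2(3) sd2 by simp
  note po_h = pushout_cancel[OF po_F2 this h2(1) s d2' h2(2)]
  have "pair_transformation C G \<rho>1 \<gamma>1 \<rho>2 ?\<gamma> (H_of \<gamma>2')"
  proof (rule pair_transformationI[OF S1(1) S2(1) T1(1) weak_double_pushoutD(1)[OF wdp] via _
        d1' _ _ d2' _ _ po_F1 po_F2 po_h])
    show "is_pullback C P e1 e2 (f_of \<gamma>1) (f_of ?\<gamma>) G" using pb_G by simp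
    show "e1 \<cdot> ?d1 = k_of \<gamma>1 \<cdot> i_of \<rho>1"
      using Comp_assoc[OF S1(3) d1(1) e1] d1(2) by simp
    show "e2 \<cdot> ?d1 = j1 \<cdot> (l_of \<rho>1 \<cdot> i_of \<rho>1)"
      using Comp_assoc[OF S1(3) d1(1) e2] Comp_assoc[OF S1(3,2) j1] pushout_commute[OF po_D2] by simp
    show "e2 \<cdot> ?d2 = k_of ?\<gamma> \<cdot> i_of \<rho>2"
      using Comp_assoc[OF S2(3) d2(1) e2] by simp
    show "e1 \<cdot> ?d2 = j2 \<cdot> (l_of \<rho>2 \<cdot> i_of \<rho>2)"
      using Comp_assoc[OF S2(3) d2(1) e1] Comp_assoc[OF S2(3,2) j2(1)] d2(3) by simp
  qed
  moreover have "residual \<gamma>1 \<rho>2 ?\<gamma> \<gamma>2'"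
    unfolding residual_def using j2 by auto
  ultimately show ?thesis
    using that wdp via unfolding parallel_independent_def by blast
qed

end

section \<open>The two correspondences and their inverse laws\<close>

theorem theorem3p2:
  fixes C :: "('o, 'm) precategory" and M :: "'m set"
    and \<rho>1 \<rho>2 :: "('o, 'm) weak_span" and G H1 H :: 'o
    and \<gamma>1 :: "('o, 'm) transformation"
  assumes "adhesive_hlr C M"
    and "is_M_weak_span C M \<rho>1" and "is_M_weak_span C M \<rho>2"
    and "G \<in> Obj C" and "H1 \<in> Obj C" and "H \<in> Obj C"
    and "\<gamma>1 \<in> weak_double_pushouts C G \<rho>1" and "H_of \<gamma>1 = H1"
  defines "Par \<equiv> {\<gamma>2 \<in> weak_double_pushouts C G \<rho>2.
      parallel_independent C \<rho>1 \<gamma>1 \<rho>2 \<gamma>2 \<and> pair_transformation C G \<rho>1 \<gamma>1 \<rho>2 \<gamma>2 H}"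
    and "Seq \<equiv> {\<gamma>2' \<in> weak_double_pushouts C H1 \<rho>2.
      H_of \<gamma>2' = H \<and> sequential_independent C \<rho>1 \<gamma>1 \<rho>2 \<gamma>2'}"
  shows "\<exists>analysis synthesis.
    (\<forall>\<gamma>2 \<in> Par. analysis \<gamma>2 \<in> Seq) \<and>
    (\<forall>\<gamma>2' \<in> Seq. synthesis \<gamma>2' \<in> Par) \<and>
    (\<forall>\<gamma>2 \<in> Par. \<forall>\<delta>2 \<in> Par.
      transformation_iso C \<gamma>2 \<delta>2 \<longrightarrow> transformation_iso C (analysis \<gamma>2) (analysis \<delta>2)) \<and>
    (\<forall>\<gamma>2' \<in> Seq. \<forall>\<delta>2' \<in> Seq.
      transformation_iso C \<gamma>2' \<delta>2' \<longrightarrow> transformation_iso C (synthesis \<gamma>2') (synthesis \<delta>2')) \<and>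
    (\<forall>\<gamma>2 \<in> Par. transformation_iso C (synthesis (analysis \<gamma>2)) \<gamma>2) \<and>
    (\<forall>\<gamma>2' \<in> Seq. transformation_iso C (analysis (synthesis \<gamma>2')) \<gamma>2')"
proof -
  interpret adhesive_hlr C M by fact
  note \<rho>1 = \<open>is_M_weak_span C M \<rho>1\<close> and \<rho>2 = \<open>is_M_weak_span C M \<rho>2\<close>
    and \<gamma>1 = \<open>\<gamma>1 \<in> weak_double_pushouts C G \<rho>1\<close>
  \<comment> \<open>Both functions are obtained by choice; \<open>residual\<close> is the only link
    to the constructions that is retained.\<close>
  have "\<forall>\<gamma> \<in> Par. \<exists>\<gamma>'. \<gamma>' \<in> Seq \<and> residual \<gamma>1 \<rho>2 \<gamma> \<gamma>'"
    using analysis[OF \<rho>1 \<rho>2 \<gamma>1] \<open>H_of \<gamma>1 = H1\<close> unfolding Par_def Seq_def by blast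
  then obtain analysis where an: "\<And>\<gamma>. \<gamma> \<in> Par \<Longrightarrow> analysis \<gamma> \<in> Seq"
    "\<And>\<gamma>. \<gamma> \<in> Par \<Longrightarrow> residual \<gamma>1 \<rho>2 \<gamma> (analysis \<gamma>)" by metis
  have "\<forall>\<gamma>' \<in> Seq. \<exists>\<gamma>. \<gamma> \<in> Par \<and> residual \<gamma>1 \<rho>2 \<gamma> \<gamma>'"
    using synthesis[OF \<rho>1 \<rho>2 \<gamma>1] \<open>H_of \<gamma>1 = H1\<close> unfolding Par_def Seq_def by blast
  then obtain synthesis where syn: "\<And>\<gamma>'. \<gamma>' \<in> Seq \<Longrightarrow> synthesis \<gamma>' \<in> Par"
    "\<And>\<gamma>'. \<gamma>' \<in> Seq \<Longrightarrow> residual \<gamma>1 \<rho>2 (synthesis \<gamma>') \<gamma>'" by metis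
  have iso_Par: "transformation_iso C \<gamma> \<delta> \<longleftrightarrow> m_of \<gamma> = m_of \<delta>" if "\<gamma> \<in> Par" "\<delta> \<in> Par" for \<gamma> \<delta>
    using transformation_iso_iff[OF \<rho>2] that unfolding Par_def by blast
  have iso_Seq: "transformation_iso C \<gamma> \<delta> \<longleftrightarrow> m_of \<gamma> = m_of \<delta>" if "\<gamma> \<in> Seq" "\<delta> \<in> Seq" for \<gamma> \<delta>
    using transformation_iso_iff[OF \<rho>2] that unfolding Seq_def by blast
  note res = residual_match_eq_iff[OF \<rho>1 \<gamma>1]
  show ?thesis
  proof (intro exI conjI ballI impI)
    show "analysis \<gamma> \<in> Seq" if "\<gamma> \<in> Par" for \<gamma> using an(1) that .
    show "synthesis \<gamma> \<in> Par" if "\<gamma> \<in> Seq" for \<gamma> using syn(1) that .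
  next
    fix \<gamma> \<delta> assume "\<gamma> \<in> Par" "\<delta> \<in> Par" "transformation_iso C \<gamma> \<delta>"
    then show "transformation_iso C (analysis \<gamma>) (analysis \<delta>)"
      using iso_Par iso_Seq an res[OF an(2) an(2)] by simp
  next
    fix \<gamma> \<delta> assume "\<gamma> \<in> Seq" "\<delta> \<in> Seq" "transformation_iso C \<gamma> \<delta>"
    then show "transformation_iso C (synthesis \<gamma>) (synthesis \<delta>)"
      using iso_Par iso_Seq syn res[OF syn(2) syn(2)] by simp
  next
    fix \<gamma> assume "\<gamma> \<in> Par"
    \<comment> \<open>Both \<open>synthesis (analysis \<gamma>)\<close> and \<gamma> are
      residual-related to the same \<open>analysis \<gamma>\<close>, so their matches agree; the
      other composite is dual.\<close>
    then show "transformation_iso C (synthesis (analysis \<gamma>)) \<gamma>"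
      using iso_Par an syn res[OF syn(2)[of "analysis \<gamma>"] an(2)[of \<gamma>]] by simp
  next
    fix \<gamma> assume "\<gamma> \<in> Seq"
    then show "transformation_iso C (analysis (synthesis \<gamma>)) \<gamma>"
      using iso_Seq an syn res[OF an(2)[of "synthesis \<gamma>"] syn(2)[of \<gamma>]] by simp
  qed
qed

end
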